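(* Let $\varepsilon>0$ and let $\mathcal{L}$ be a curve lying in the half-plane $\operatorname{Re}\mu\ge\varepsilon$ and going to infinity. Suppose that, as $\mu\to\infty$ along $\mathcal{L}$, $\nu=\nu(\mu)$ is bounded and $-1<\operatorname{Re}\nu<\operatorname{Re}\mu$. If $K$ is an arbitrary fixed positive integer, then as $\mu\to\infty$ along $\mathcal{L}$, $$e^{\alpha\mu}P_\nu^{-\mu}(\tanh\alpha)=\frac{1}{\Gamma(\mu-\nu)}\left(\sum_{k=0}^{K-1}\frac{(\nu+1)_k\,t_{k,\nu}(\alpha)}{\mu^{k+\nu+1}\,k!}+O\left(\frac{1}{\mu^{K+\nu+1}}\right)\right),$$ uniformly with respect to $\alpha\in\mathbb{R}$.
   Context: For $x\in(-1,1)$ and $\nu,\mu\in\mathbb{C}$ the Ferrers function of the first kind is $P_\nu^{-\mu}(x)=\left(\frac{1-x}{1+x}\right)^{\mu/2}\frac{F(-\nu,\nu+1;1+\mu;\frac{1-x}{2})}{\Gamma(1+\mu)}$, where $F$ is the Gauss hypergeometric function. $(a)_k=\Gamma(a+k)/\Gamma(a)$. The functions $t_{k,\nu}(\alpha)$ are defined for $k\in\mathbb{N}_0$ and $\alpha\in\mathbb{R}$ by $$t_{k,\nu}(\alpha)=\frac{1}{\cosh^{\nu}\alpha}\left(\frac{d^k}{dx^k}\left(\frac{\sinh(x+\alpha)-\sinh\alpha}{x}\right)^{\nu}\right)_{x=0},$$ so that $t_{0,\nu}=1$, $t_{1,\nu}(\alpha)=\frac{\nu}{2}\tanh\alpha$,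 $t_{2,\nu}(\alpha)=\frac{\nu(\nu-1)}{4}\tanh^2\alpha+\frac{\nu}{3}$. Powers of $\mu$ are principal. *)

theory Defs
  imports "HOL-Analysis.Analysis"
begin

text \<open>
  The Gauss hypergeometric function as the sum of its power series, i.e. on the open unit disc.
  The Ferrers function only needs it at \<^term>\<open>(1 - x) / 2\<close>, which lies in the open unit interval.
\<close>

definition gauss_F :: "complex \<Rightarrow> complex \<Rightarrow> complex \<Rightarrow> complex \<Rightarrow> complex" where
  "gauss_F a b c z = eval_fps (fps_hypergeo [a, b] [c] 1) z"

text \<open>
  \<^term>\<open>ferrers_P_neg \<nu> \<mu> x\<close> is the Ferrers function of the first kind of degree \<open>\<nu>\<close> and
  order \<open>-\<mu>\<close> (note the sign), for \<open>-1 < x < 1\<close>. For \<open>\<mu>\<close> a negative integer, where the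
  quotient below would have to be read as a limit, the value is 0 because of
  \<open>1 / 0 = 0\<close>.
\<close>

definition ferrers_P_neg :: "complex \<Rightarrow> complex \<Rightarrow> real \<Rightarrow> complex" where
  "ferrers_P_neg \<nu> \<mu> x =
     complex_of_real ((1 - x) / (1 + x)) powr (\<mu> / 2) *
     (gauss_F (- \<nu>) (\<nu> + 1) (1 + \<mu>) (complex_of_real ((1 - x) / 2)) / Gamma (1 + \<mu>))"

text \<open>
  The difference quotient of \<open>sinh\<close> at \<open>\<alpha>\<close>, with its removable singularity at 0 filled in.
  It is positive at 0, so its principal powers are holomorphic near 0, and the iterated complex
  derivatives at 0 agree with those along the real axis.
\<close>

definition sinh_quot :: "real \<Rightarrow> complex \<Rightarrow> complex" where
  "sinh_quot \<alpha> x =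
     (if x = 0 then cosh (of_real \<alpha>) else (sinh (x + of_real \<alpha>) - sinh (of_real \<alpha>)) / x)"

definition t_coeff :: "nat \<Rightarrow> complex \<Rightarrow> real \<Rightarrow> complex" where
  "t_coeff k \<nu> \<alpha> =
     1 / complex_of_real (cosh \<alpha>) powr \<nu> * (deriv ^^ k) (\<lambda>x. sinh_quot \<alpha> x powr \<nu>) 0"

definition curve_to_infinity :: "complex set \<Rightarrow> bool" where
  "curve_to_infinity L \<longleftrightarrow>
     (\<exists>\<gamma> :: real \<Rightarrow> complex.
        continuous_on {0..} \<gamma> \<and> filterlim \<gamma> at_infinity at_top \<and> L = \<gamma> ` {0..})"

text \<open>The filter of \<open>\<mu> \<rightarrow> \<infinity>\<close> along \<open>L\<close>, i.e. with \<open>\<mu>\<close> restricted to \<open>L\<close>.\<close>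

definition at_infinity_along :: "complex set \<Rightarrow> complex filter" where
  "at_infinity_along L = inf at_infinity (principal L)"

end

theory Submission
  imports Defs "HOL-Complex_Analysis.Complex_Analysis" "HOL-Real_Asymp.Real_Asymp"
begin

text \<open>
  Put \<open>z = (1 - tanh \<alpha>) / 2\<close>. Since \<open>(1 - tanh \<alpha>) / (1 + tanh \<alpha>) = e\<^sup>-\<^sup>2\<^sup>\<alpha>\<close>, the left-hand side is
  \<open>F(-\<nu>, \<nu> + 1; 1 + \<mu>; z) / \<Gamma>(1 + \<mu>)\<close>. The tail of the hypergeometric series from index \<open>K\<close> on is
  \<open>O(1 / \<mu>\<^sup>K)\<close> uniformly for \<open>0 < z < 1\<close>, because \<open>Re \<mu> \<ge> \<epsilon>\<close> makes the majorant converge up to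
  \<open>z = 1\<close>. Each of the remaining terms contains \<open>\<Gamma>(\<mu> - \<nu>) / \<Gamma>(\<mu> + n + 1)\<close>, which has an expansion
  in powers of \<open>1 / \<mu>\<close> with coefficients read off from \<open>e\<^sup>\<nu>\<^sup>s ((1 - e\<^sup>-\<^sup>s) / s) powr (\<nu> + n)\<close>. Finally
  \<open>(sinh(s + \<alpha>) - sinh \<alpha>) / (s cosh \<alpha>) = e\<^sup>s p(s) (1 - z s p(s))\<close> with \<open>p(s) = (1 - e\<^sup>-\<^sup>s) / s\<close>, and
  expanding the power \<open>\<nu>\<close> of the last factor binomially identifies the collected coefficients with
  \<open>t_coeff\<close>.
\<close>

unbundle no vec_syntax

subsection \<open>The hypergeometric series for large third parameter\<close>

lemma norm_pochhammer_Re_mono: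
  fixes x :: complex
  assumes "0 \<le> a" "a \<le> Re x"
  shows "pochhammer a n \<le> norm (pochhammer x n)"
proof -
  have "a + real i \<le> norm (x + of_nat i)" for i
    using complex_Re_le_cmod[of "x + of_nat i"] assms by simp
  then show ?thesis
    unfolding pochhammer_prod prod_norm[symmetric] using assms
    by (intro prod_mono) auto
qed

text \<open>In the closed right half-plane a shift by \<open>1 + i\<close> moves \<open>x\<close> no
  closer to the origin, so each of the \<open>n\<close> factors has norm at least
  \<open>norm x\<close>. This is the source of the decay \<open>1 / norm \<mu> ^ N\<close> of the
  hypergeometric tail.\<close>

lemma power_norm_le_norm_pochhammer:
  fixes x :: complex
  assumes "0 \<le> Re x"
  shows "norm x ^ n \<le> norm (pochhammer (1 + x) n)"
proof -
  have "norm x \<le> norm (1 + x + of_nat i)" for i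
    using assms by (auto simp: cmod_def power2_eq_square intro!: real_sqrt_le_mono add_mono mult_mono)
  then have "(\<Prod>i<n. norm x) \<le> (\<Prod>i<n. norm (1 + x + of_nat i))"
    by (intro prod_mono) auto
  then show ?thesis
    unfolding pochhammer_prod prod_norm[symmetric] by (simp add: atLeast0LessThan)
qed

text \<open>The i-th factors of the two symbols are paired, because their product is exactly
  \<open>i (i + 1) - x (x + 1)\<close>: the terms linear in \<open>i\<close> do not depend on
  \<open>x\<close>. Separate bounds \<open>(i + B) (i + B + 1)\<close> would grow too fast for the
  majorant to converge when \<open>e\<close> is small. The final \<open>+ 1\<close> keeps the added
  constant strictly positive.\<close>

lemma norm_pochhammer_mult_le:
  fixes x :: complex
  assumes "norm x \<le> B"
  shows "norm (pochhammer (- x) n * pochhammer (x + 1) n)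
           \<le> (\<Prod>i<n. real i * (real i + 1) + (B * (B + 1) + 1))"
proof -
  have "0 \<le> B" using assms norm_ge_zero[of x] by linarith
  have "norm ((- x + of_nat i) * (x + 1 + of_nat i)) \<le> real i * (real i + 1) + (B * (B + 1) + 1)" for i
  proof -
    have "(- x + of_nat i) * (x + 1 + of_nat i) = of_real (real i * (real i + 1)) - x * (x + 1)"
      by (simp add: algebra_simps)
    also have "norm \<dots> \<le> real i * (real i + 1) + norm x * norm (x + 1)"
      by (rule order_trans[OF norm_triangle_ineq4])
         (simp add: norm_mult del: of_real_mult of_real_add)
    also have "norm x * norm (x + 1) \<le> B * (B + 1)"
      using assms norm_triangle_ineq[of x 1] \<open>0 \<le> B\<close> by (intro mult_mono) auto
    finally show ?thesis by simp
  qed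
  then show ?thesis
    unfolding pochhammer_prod prod.distrib[symmetric] prod_norm[symmetric] atLeast0LessThan
    by (intro prod_mono) auto
qed

text \<open>Consecutive terms have quotient \<open>1 + (1 + e) / n + ...\<close>, so Raabe's test
  gives the limit \<open>1 + e\<close>. It exceeds 1 precisely because \<open>e\<close> is positive,
  and no help from powers of \<open>z\<close> is required.\<close>

lemma summable_gauss_majorant:
  fixes e M :: real
  assumes "0 < e" "0 < M"
  shows "summable (\<lambda>n. (\<Prod>i<n. real i * (real i + 1) + M) / (pochhammer (1 + e) n * fact n))"
    (is "summable ?f")
proof (rule raabes_test_convergence)
  have pos: "?f n > 0" for n
    using assms by (intro divide_pos_pos prod_pos mult_pos_pos pochhammer_pos) (auto intro: add_nonneg_pos)
  then show "eventually (\<lambda>n. ?f n > 0) sequentially" by simp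
  have "real n * (?f n / ?f (Suc n) - 1)
      = real n * ((1 + e + real n) * (real n + 1) / (real n * (real n + 1) + M) - 1)" for n
  proof -
    define q where "q = (\<Prod>i<n. real i * (real i + 1) + M)"
    have pos: "q > 0" "pochhammer (1 + e) n > 0" "real n * (real n + 1) + M > 0" "1 + e + real n > 0"
      using assms by (auto simp: q_def intro!: prod_pos pochhammer_pos add_nonneg_pos)
    have "x / (y * z) / (x * u / (y * v * (w * z))) = v * w / u"
      if "x > 0" "y > 0" "z > 0" "u > 0" "v > 0" for x y z u v w :: real
      using that by (simp add: field_simps)
    from this[OF pos(1,2) fact_gt_zero pos(3,4), of n "real (Suc n)"] show ?thesis
      unfolding prod.lessThan_Suc pochhammer_Suc fact_Suc q_def[symmetric] by (simp add: add.commute)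
  qed
  moreover have "(\<lambda>n. real n * ((1 + e + real n) * (real n + 1) / (real n * (real n + 1) + M) - 1))
      \<longlonglongrightarrow> 1 + e"
    using assms by real_asymp
  ultimately have "(\<lambda>n. real n * (?f n / ?f (Suc n) - 1)) \<longlonglongrightarrow> 1 + e" by (simp only:)
  then have "liminf (\<lambda>n. ereal (real n * (?f n / ?f (Suc n) - 1))) = ereal (1 + e)"
    by (intro lim_imp_Liminf) simp_all
  then show "1 < liminf (\<lambda>n. ereal (real n * (?f n / ?f (Suc n) - 1)))"
    using assms by simp
qed

text \<open>In a tail term the denominator splits as
  \<open>pochhammer (1 + \<mu>) N * pochhammer (1 + \<mu> + N) n\<close>. The first factor is at
  least \<open>norm \<mu> ^ N\<close>, the second at least its real counterpart with
  \<open>e\<close> for \<open>\<mu>\<close>; what remains is the summable majorant times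
  \<open>pochhammer (1 + e) N\<close>. The constant is thus independent of \<open>\<nu>\<close>,
  \<open>\<mu>\<close> and \<open>z\<close>.\<close>

lemma gauss_F_large_c:
  fixes e B :: real
  assumes "0 < e"
  shows "\<exists>C. \<forall>\<nu> \<mu> z. norm \<nu> \<le> B \<longrightarrow> e \<le> Re \<mu> \<longrightarrow> norm z \<le> 1 \<longrightarrow>
     norm (gauss_F (- \<nu>) (\<nu> + 1) (1 + \<mu>) z
        - (\<Sum>n<N. pochhammer (- \<nu>) n * pochhammer (\<nu> + 1) n / (pochhammer (1 + \<mu>) n * fact n) * z ^ n))
       \<le> C / norm \<mu> ^ N"
proof -
  define M where "M = B * (B + 1) + 1"
  define a where "a n = (\<Prod>i<n. real i * (real i + 1) + M) / (pochhammer (1 + e) n * fact n)" for n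
  define C where "C = pochhammer (1 + e) N * (\<Sum>n. a n)"
  have "norm (gauss_F (- \<nu>) (\<nu> + 1) (1 + \<mu>) z
        - (\<Sum>n<N. pochhammer (- \<nu>) n * pochhammer (\<nu> + 1) n / (pochhammer (1 + \<mu>) n * fact n) * z ^ n))
       \<le> C / norm \<mu> ^ N"
    if \<nu>: "norm \<nu> \<le> B" and \<mu>: "e \<le> Re \<mu>" and z: "norm z \<le> 1" for \<nu> \<mu> z
  proof -
    have "0 \<le> B" using \<nu> norm_ge_zero[of \<nu>] by linarith
    then have "0 < M" unfolding M_def by (intro add_nonneg_pos mult_nonneg_nonneg) auto
    then have a: "summable a" unfolding a_def using summable_gauss_majorant assms by blast
    have a_nonneg: "0 \<le> a n" for n
      using assms \<open>0 < M\<close> unfolding a_def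
      by (intro divide_nonneg_nonneg prod_nonneg mult_nonneg_nonneg pochhammer_nonneg) auto
    have "\<mu> \<noteq> 0" using \<mu> assms by auto
    define t where "t n = pochhammer (- \<nu>) n * pochhammer (\<nu> + 1) n / (pochhammer (1 + \<mu>) n * fact n) * z ^ n"
      for n
    have zn: "norm z ^ n \<le> 1" for n using z by (simp add: power_le_one)
    have p: "pochhammer (1 + e) n \<le> norm (pochhammer (1 + \<mu>) n)" "0 < pochhammer (1 + e) n" for n
      using assms \<mu> by (auto intro!: norm_pochhammer_Re_mono pochhammer_pos)
    have num: "norm (pochhammer (- \<nu>) n * pochhammer (\<nu> + 1) n) \<le> (\<Prod>i<n. real i * (real i + 1) + M)" for n
      unfolding M_def using norm_pochhammer_mult_le[OF \<nu>] .
    have t_eq: "norm (t n) = norm (pochhammer (- \<nu>) n * pochhammer (\<nu> + 1) n) * norm z ^ n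
        / (norm (pochhammer (1 + \<mu>) n) * fact n)" for n
      by (simp add: t_def norm_mult norm_divide norm_power)
    have num': "norm (pochhammer (- \<nu>) n * pochhammer (\<nu> + 1) n) * norm z ^ n
        \<le> (\<Prod>i<n. real i * (real i + 1) + M)" for n
      using mult_mono[OF num[of n] zn[of n]] \<open>0 < M\<close> by (simp add: prod_nonneg)
    have t_le: "norm (t n) \<le> a n" for n
      unfolding t_eq a_def using num'[of n] p[of n] \<open>0 < M\<close>
      by (intro frac_le mult_right_mono prod_nonneg) auto
    have t_tail: "norm (t (n + N)) \<le> pochhammer (1 + e) N / norm \<mu> ^ N * a (n + N)" for n
    proof -
      have "norm \<mu> ^ N / pochhammer (1 + e) N * pochhammer (1 + e) (n + N)
          = norm \<mu> ^ N * pochhammer (1 + e + of_nat N) n"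
        using p(2)[of N] pochhammer_product'[of "1 + e" N n] by (simp add: add.commute)
      also have "\<dots> \<le> norm (pochhammer (1 + \<mu>) N) * norm (pochhammer (1 + \<mu> + of_nat N) n)"
        using \<mu> assms
        by (intro mult_mono power_norm_le_norm_pochhammer norm_pochhammer_Re_mono pochhammer_nonneg) auto
      also have "\<dots> = norm (pochhammer (1 + \<mu>) (n + N))"
        using pochhammer_product'[of "1 + \<mu>" N n] by (simp add: add.commute norm_mult)
      finally have "norm \<mu> ^ N / pochhammer (1 + e) N * pochhammer (1 + e) (n + N)
        \<le> norm (pochhammer (1 + \<mu>) (n + N))" .
      then have "norm (t (n + N)) \<le> (\<Prod>i<n + N. real i * (real i + 1) + M)
          / ((norm \<mu> ^ N / pochhammer (1 + e) N * pochhammer (1 + e) (n + N)) * fact (n + N))"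
        unfolding t_eq using num'[of "n + N"] p[of "n + N"] p[of N] \<open>0 < M\<close> \<open>\<mu> \<noteq> 0\<close>
        by (intro frac_le mult_right_mono prod_nonneg) auto
      then show ?thesis by (simp add: a_def field_simps)
    qed
    have "summable t" using a t_le by (rule summable_comparison_test'[where N = 0])
    have "gauss_F (- \<nu>) (\<nu> + 1) (1 + \<mu>) z = suminf t"
      by (simp add: gauss_F_def eval_fps_def t_def[abs_def] mult_ac)
    also have "\<dots> = (\<Sum>n. t (n + N)) + (\<Sum>n<N. t n)"
      using \<open>summable t\<close> by (rule suminf_split_initial_segment)
    finally have "norm (gauss_F (- \<nu>) (\<nu> + 1) (1 + \<mu>) z - (\<Sum>n<N. t n)) = norm (\<Sum>n. t (n + N))"
      by simp
    also have "\<dots> \<le> (\<Sum>n. pochhammer (1 + e) N / norm \<mu> ^ N * a (n + N))"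
      using a t_tail by (intro norm_suminf_le summable_mult summable_ignore_initial_segment)
    also have "\<dots> = pochhammer (1 + e) N / norm \<mu> ^ N * (\<Sum>n. a (n + N))"
      using a by (intro suminf_mult summable_ignore_initial_segment)
    also have "\<dots> \<le> pochhammer (1 + e) N / norm \<mu> ^ N * (\<Sum>n. a n)"
    proof (intro mult_left_mono)
      have "0 \<le> (\<Sum>n<N. a n)" using a_nonneg by (simp add: sum_nonneg)
      then show "(\<Sum>n. a (n + N)) \<le> (\<Sum>n. a n)"
        using suminf_split_initial_segment[OF a, of N] by linarith
    qed (use p[of N] in auto)
    finally show ?thesis by (simp add: t_def C_def)
  qed
  then show ?thesis by blast
qed

subsection \<open>Complex powers of power series\<close>

text \<open>Meaningful only when the constant coefficient is 1.\<close>

definition fps_powr :: "complex fps \<Rightarrow> complex \<Rightarrow> complex fps" where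
  "fps_powr F c = fps_binomial c oo (F - 1)"

lemma fps_powr_nth_0 [simp]: "fps_powr F c $ 0 = 1"
  by (simp add: fps_powr_def)

lemma fps_powr_add:
  "F $ 0 = 1 \<Longrightarrow> fps_powr F (c + d) = fps_powr F c * fps_powr F d"
  by (simp add: fps_powr_def fps_binomial_add_mult fps_compose_mult_distrib)

lemma fps_powr_of_nat:
  assumes "F $ 0 = 1"
  shows "fps_powr F (of_nat n) = F ^ n"
proof -
  have "fps_powr F (of_nat n) = ((1 + fps_X) oo (F - 1)) ^ n"
    using assms by (simp add: fps_powr_def fps_binomial_of_nat fps_compose_power)
  also have "(1 + fps_X) oo (F - 1) = F"
    using assms by (simp add: fps_compose_add_distrib)
  finally show ?thesis .
qed

text \<open>The binomial series satisfies \<open>(1 + X) y' = c y\<close>; composing this equation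
  with \<open>F - 1\<close> and applying the chain rule gives the logarithmic derivative of the
  power, in a form free of division.\<close>

lemma fps_deriv_fps_powr:
  assumes "F $ 0 = 1"
  shows "F * fps_deriv (fps_powr F c) = fps_const c * fps_powr F c * fps_deriv F"
proof -
  have 0: "(F - 1) $ 0 = 0" using assms by simp
  have "(1 + fps_X) * fps_deriv (fps_binomial c)
      = fps_const c * fps_binomial c * (inverse (1 + fps_X) * (1 + fps_X))"
    unfolding fps_binomial_deriv by (subst fps_divide_unit) (simp_all only: mult_ac, simp)
  also have "inverse (1 + fps_X) * (1 + fps_X) = (1 :: complex fps)"
    by (intro inverse_mult_eq_1) simp
  finally have "(1 + fps_X) * fps_deriv (fps_binomial c) = fps_const c * fps_binomial c"
    by simp
  then have "((1 + fps_X) oo (F - 1)) * (fps_deriv (fps_binomial c) oo (F - 1))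
      = fps_const c * fps_powr F c"
    by (metis 0 fps_compose_mult_distrib fps_const_compose fps_powr_def)
  moreover have "(1 + fps_X) oo (F - 1) = F"
    using 0 by (simp add: fps_compose_add_distrib)
  ultimately have "F * (fps_deriv (fps_binomial c) oo (F - 1)) = fps_const c * fps_powr F c"
    by simp
  moreover have "fps_deriv (fps_powr F c) = (fps_deriv (fps_binomial c) oo (F - 1)) * fps_deriv F"
    unfolding fps_powr_def using fps_compose_deriv[OF 0] by simp
  ultimately show ?thesis by (simp add: mult.assoc[symmetric])
qed

text \<open>The quotient of two solutions with constant coefficient 1 has derivative zero, hence
  equals 1. Identities between complex powers below reduce to checking this first-order equation,
  which avoids any discussion of branches of the logarithm.\<close>

lemma fps_powr_unique:
  assumes F0: "F $ 0 = 1" and H0: "H $ 0 = 1"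
    and ode: "F * fps_deriv H = fps_const c * H * fps_deriv F"
  shows "H = fps_powr F c"
proof -
  define G where "G = fps_powr F c"
  have G0: "G $ 0 = 1" by (simp add: G_def)
  have "F * (fps_deriv H * G) = F * fps_deriv H * G" by (simp only: mult_ac)
  also have "\<dots> = (fps_const c * G * fps_deriv F) * H" unfolding ode by (simp only: mult_ac)
  also have "\<dots> = (F * fps_deriv G) * H"
    unfolding G_def fps_deriv_fps_powr[OF F0] ..
  also have "\<dots> = F * (H * fps_deriv G)" by (simp only: mult_ac)
  finally have "fps_deriv H * G = H * fps_deriv G" using F0 by auto
  moreover have inv: "inverse G * G = 1" using G0 by (intro inverse_mult_eq_1) simp
  moreover have "fps_deriv H = fps_deriv H * (inverse G * G)"
    using inv by simp
  ultimately have "fps_deriv H = H * (fps_deriv G * inverse G)"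
    by (metis mult.assoc mult.commute)
  then have "fps_deriv (H * inverse G) = 0"
    using G0 by (simp add: fps_inverse_deriv power2_eq_square mult_ac)
  then have "H * inverse G = fps_const ((H * inverse G) $ 0)"
    unfolding fps_deriv_eq_0_iff .
  also have "(H * inverse G) $ 0 = 1" using H0 G0 by simp
  finally have "H * (inverse G * G) = G" by (metis fps_const_1_eq_1 mult.assoc mult_1)
  then show ?thesis by (simp only: inv mult_1_right G_def[symmetric])
qed

lemma fps_powr_mult:
  assumes "F $ 0 = 1" "G $ 0 = 1"
  shows "fps_powr (F * G) c = fps_powr F c * fps_powr G c"
proof (rule fps_powr_unique[symmetric])
  have "F * G * fps_deriv (fps_powr F c * fps_powr G c)
      = (F * fps_deriv (fps_powr F c)) * (G * fps_powr G c)
        + (G * fps_deriv (fps_powr G c)) * (F * fps_powr F c)"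
    by (simp add: algebra_simps)
  also have "\<dots> = fps_const c * (fps_powr F c * fps_powr G c) * fps_deriv (F * G)"
    unfolding fps_deriv_fps_powr[OF assms(1)] fps_deriv_fps_powr[OF assms(2)]
    by (simp add: algebra_simps)
  finally show "F * G * fps_deriv (fps_powr F c * fps_powr G c)
      = fps_const c * (fps_powr F c * fps_powr G c) * fps_deriv (F * G)" .
qed (use assms in simp_all)

lemma fps_powr_exp: "fps_powr (fps_exp a) c = fps_exp (c * a)"
  by (rule fps_powr_unique[symmetric]) (simp_all add: fps_const_mult[symmetric] mult_ac del: fps_const_mult)

text \<open>Since \<open>f 0 = 1\<close> lies off the branch cut, the principal power is analytic at
  0. Its Taylor series inherits the differential equation from the function, and uniqueness
  identifies it with the formal power.\<close>

lemma has_fps_expansion_powr: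
  fixes f :: "complex \<Rightarrow> complex"
  assumes f: "f has_fps_expansion F" and F0: "F $ 0 = 1"
  shows "(\<lambda>x. f x powr c) has_fps_expansion fps_powr F c"
proof -
  define H where "H = fps_expansion (\<lambda>x. f x powr c) 0"
  have f0: "f 0 = 1" using has_fps_expansion_imp_0_eq_fps_nth_0[OF f] F0 by simp
  have an: "f analytic_on {0}" using f has_fps_expansion_imp_analytic_0 by blast
  then have "(\<lambda>x. f x powr c) analytic_on {0}"
    using f0 by (intro analytic_intros) auto
  then have H: "(\<lambda>x. f x powr c) has_fps_expansion H"
    unfolding H_def by (rule analytic_at_imp_has_fps_expansion_0)
  obtain S where S: "open S" "0 \<in> S" "f holomorphic_on S"
    using an analytic_at by blast
  have "\<forall>\<^sub>F x in nhds 0. x \<in> S" using S eventually_nhds_in_open by blast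
  \<comment> \<open>The unit disc around 1 lies in the open right half-plane, where the principal
    power is differentiable.\<close>
  moreover have "\<forall>\<^sub>F x in nhds 0. f x \<in> ball 1 1"
  proof (rule topological_tendstoD)
    show "(f \<longlongrightarrow> f 0) (nhds 0)"
      using analytic_at_imp_isCont[OF an] by (simp add: isCont_def tendsto_at_iff_tendsto_nhds)
  qed (use f0 in auto)
  ultimately have "\<forall>\<^sub>F x in nhds 0. f x * deriv (\<lambda>x. f x powr c) x = c * f x powr c * deriv f x"
  proof eventually_elim
    case (elim x)
    then have "\<bar>1 - Re (f x)\<bar> < 1"
      using abs_Re_le_cmod[of "1 - f x"] by (simp add: dist_norm)
    then have Re: "f x \<notin> \<real>\<^sub>\<le>\<^sub>0"
      by (auto simp: complex_nonpos_Reals_iff)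
    then have "f x \<noteq> 0" by auto
    have "(f has_field_derivative deriv f x) (at x)"
      using S elim by (intro holomorphic_derivI) auto
    then have "((\<lambda>x. f x powr c) has_field_derivative c * f x powr (c - 1) * deriv f x) (at x)"
      by (rule DERIV_chain2[where f = "\<lambda>z. z powr c" and g = f, OF has_field_derivative_powr[OF Re]])
    then have "deriv (\<lambda>x. f x powr c) x = c * f x powr (c - 1) * deriv f x"
      by (rule DERIV_imp_deriv)
    then show ?case using \<open>f x \<noteq> 0\<close> by (simp add: powr_diff)
  qed
  then have "(\<lambda>x. f x * deriv (\<lambda>x. f x powr c) x) has_fps_expansion G \<longleftrightarrow>
      (\<lambda>x. c * f x powr c * deriv f x) has_fps_expansion G" for G
    by (rule has_fps_expansion_cong) simp
  moreover have "(\<lambda>x. f x * deriv (\<lambda>x. f x powr c) x) has_fps_expansion F * fps_deriv H"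
    using f H by (intro fps_expansion_intros)
  moreover have "(\<lambda>x. c * f x powr c * deriv f x) has_fps_expansion fps_const c * H * fps_deriv F"
    using f H by (intro fps_expansion_intros)
  ultimately have "F * fps_deriv H = fps_const c * H * fps_deriv F"
    by (metis (no_types) fps_expansion_unique_complex)
  moreover have "H $ 0 = 1"
    using has_fps_expansion_imp_0_eq_fps_nth_0[OF H] f0 by simp
  ultimately show ?thesis using fps_powr_unique[OF F0] H by simp
qed

section \<open>Power series behind the quotient of two Gamma functions\<close>

lemma fps_X_mult_shift_exp: "fps_X * fps_shift 1 (1 - fps_exp (- 1)) = (1 - fps_exp (- 1) :: complex fps)"
  by (rule fps_ext) simp

text \<open>
  \<open>\<Gamma>(\<mu> + a) \<Gamma>(b - a) / \<Gamma>(\<mu> + b)\<close> is the Laplace transform of \<open>f(s) = e\<^sup>-\<^sup>a\<^sup>s (1 - e\<^sup>-\<^sup>s) powr (b - a - 1)\<close>;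
  this is the power series of \<open>f(s) / s powr (b - a - 1)\<close>.
\<close>

definition gamma_ratio_fps :: "complex \<Rightarrow> complex \<Rightarrow> complex fps" where
  "gamma_ratio_fps a b = fps_exp (- a) * fps_powr (fps_shift 1 (1 - fps_exp (- 1))) (b - a - 1)"

text \<open>The function \<open>f(s)\<close> of the Laplace integral satisfies
  \<open>(1 - e^-s) f' = (-a + (b - 1) e^-s) f\<close>. Writing \<open>f = s^(b-a-1) H\<close> and
  multiplying by \<open>s\<close> removes the fractional power and leaves this equation for the
  series \<open>H\<close>.\<close>

lemma gamma_ratio_fps_ode:
  "(1 - fps_exp (- 1)) * (fps_X * fps_deriv (gamma_ratio_fps a b) + fps_const (b - a - 1) * gamma_ratio_fps a b)
     = fps_X * ((fps_const (- a) + fps_const (b - 1) * fps_exp (- 1)) * gamma_ratio_fps a b)"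
proof -
  define P :: "complex fps" where "P = fps_shift 1 (1 - fps_exp (- 1))"
  define H where "H = fps_powr P (b - a - 1)"
  define e where "e = fps_exp (- a)"
  define u :: "complex fps" where "u = fps_exp (- 1)"
  have XP: "fps_X * P = 1 - u" unfolding P_def u_def by (rule fps_X_mult_shift_exp)
  have "fps_deriv (fps_X * P) = fps_deriv (1 - u)" unfolding XP ..
  then have P': "P + fps_X * fps_deriv P = u"
    by (simp add: u_def add.commute fps_const_neg[symmetric] del: fps_const_neg)
  have H': "P * fps_deriv H = fps_const (b - a - 1) * H * fps_deriv P"
    unfolding H_def by (rule fps_deriv_fps_powr) (simp add: P_def)
  have e': "fps_deriv (e * H) = fps_const (- a) * (e * H) + e * fps_deriv H"
    by (simp add: e_def algebra_simps)
  have c: "fps_const (- a) = - fps_const a" "fps_const (b - 1) = fps_const b - 1"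
    "fps_const (b - a - 1) = fps_const b - fps_const a - 1"
    by simp_all
  have ring: "x * e * h * ((1 - v) * - k + (l - k - 1) * v) = x * ((- k + (l - 1) * v) * (e * h))"
    for x e h v k l :: "complex fps"
    by (simp add: algebra_simps)
  have "(1 - u) * (fps_X * fps_deriv (e * H) + fps_const (b - a - 1) * (e * H))
      = (fps_X * P) * (fps_X * fps_deriv (e * H) + fps_const (b - a - 1) * (e * H))"
    unfolding XP ..
  also have "\<dots> = fps_X * e * ((fps_X * P) * (fps_const (- a) * H) + fps_X * (P * fps_deriv H)
        + fps_const (b - a - 1) * P * H)"
    unfolding e' by (simp only: algebra_simps)
  also have "\<dots> = fps_X * e * H * ((fps_X * P) * fps_const (- a)
        + fps_const (b - a - 1) * (P + fps_X * fps_deriv P))"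
    unfolding H' by (simp only: algebra_simps)
  also have "\<dots> = fps_X * ((fps_const (- a) + fps_const (b - 1) * u) * (e * H))"
    unfolding XP P' c by (rule ring)
  finally show ?thesis by (simp add: gamma_ratio_fps_def e_def H_def P_def u_def)
qed

text \<open>Both sides of the differential equation are compared at \<open>X^(m+1)\<close>. The
  alternating factors are the coefficients of \<open>e^-s\<close>.\<close>

lemma gamma_ratio_fps_rec:
  fixes a b :: complex
  defines "E \<equiv> gamma_ratio_fps a b"
  shows "(\<Sum>k\<le>m. (- 1) ^ (m + 1 - k) / fact (m + 1 - k) * (b - a - 1 + of_nat k) * E $ k)
       + (b - 1) * (\<Sum>k\<le>m. (- 1) ^ (m - k) / fact (m - k) * E $ k) - a * E $ m = 0"
proof -
  define u :: "complex fps" where "u = fps_exp (- 1)"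
  define D where "D = fps_X * fps_deriv E + fps_const (b - a - 1) * E"
  have D: "D $ k = (b - a - 1 + of_nat k) * E $ k" for k
    by (cases k) (simp_all add: D_def algebra_simps)
  have "(D * (1 - u)) $ Suc m = (fps_X * ((fps_const (- a) + fps_const (b - 1) * u) * E)) $ Suc m"
    using gamma_ratio_fps_ode[of a b] by (simp add: D_def u_def E_def mult.commute)
  moreover have "(D * (1 - u)) $ Suc m
      = - (\<Sum>k\<le>m. (- 1) ^ (m + 1 - k) / fact (m + 1 - k) * (b - a - 1 + of_nat k) * E $ k)"
  proof -
    \<comment> \<open>The term with index \<open>m + 1\<close> is split off: it vanishes because
      \<open>1 - u\<close> has no constant term, so the recurrence ends at
      \<open>E $ m\<close>.\<close>
    have "(D * (1 - u)) $ Suc m = (\<Sum>k\<le>m. D $ k * (1 - u) $ (Suc m - k)) + D $ Suc m * (1 - u) $ 0"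
      unfolding fps_mult_nth atLeast0AtMost by simp
    also have "(1 - u) $ 0 = 0" by (simp add: u_def)
    also have "(\<Sum>k\<le>m. D $ k * (1 - u) $ (Suc m - k))
        = (\<Sum>k\<le>m. - ((- 1) ^ (m + 1 - k) / fact (m + 1 - k) * (b - a - 1 + of_nat k) * E $ k))"
      by (intro sum.cong) (auto simp: D u_def)
    finally show ?thesis by (simp add: sum_negf)
  qed
  moreover have "(fps_X * ((fps_const (- a) + fps_const (b - 1) * u) * E)) $ Suc m
      = - a * E $ m + (b - 1) * (\<Sum>k\<le>m. (- 1) ^ (m - k) / fact (m - k) * E $ k)"
  proof -
    have "(E * u) $ m = (\<Sum>k\<le>m. (- 1) ^ (m - k) / fact (m - k) * E $ k)"
      unfolding fps_mult_nth atLeast0AtMost by (simp add: u_def mult.commute)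
    moreover have "(fps_const (- a) + fps_const (b - 1) * u) * E
        = fps_const (- a) * E + fps_const (b - 1) * (E * u)"
      by (simp only: algebra_simps)
    ultimately show ?thesis by (simp del: fps_const_neg fps_const_sub)
  qed
  ultimately show ?thesis by (simp add: algebra_simps)
qed

lemma norm_gbinomial_le:
  fixes c :: complex
  assumes "norm c \<le> B"
  shows "norm (c gchoose k) \<le> pochhammer B k / fact k"
proof -
  have "norm (pochhammer (- c) k) \<le> pochhammer B k"
    unfolding pochhammer_prod prod_norm[symmetric]
  proof (intro prod_mono conjI)
    fix i show "norm (- c + of_nat i) \<le> B + of_nat i"
      using norm_triangle_ineq[of "- c" "of_nat i"] assms by simp
  qed auto
  then show ?thesis
    by (simp add: gbinomial_pochhammer norm_divide norm_mult norm_power divide_right_mono)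
qed

text \<open>For fixed \<open>m\<close> the coefficient is a polynomial in \<open>a\<close> and
  \<open>b\<close>, hence bounded on bounded sets. The explicit bound replaces \<open>norm a\<close>
  by \<open>B\<close> and the exponent \<open>b - a - 1\<close> by \<open>2 * B + 1\<close>.\<close>

lemma gamma_ratio_fps_bounded:
  "\<exists>C. \<forall>a b. norm a \<le> B \<longrightarrow> norm b \<le> B \<longrightarrow> norm (gamma_ratio_fps a b $ m) \<le> C"
proof -
  define P :: "complex fps" where "P = fps_shift 1 (1 - fps_exp (- 1)) - 1"
  define p where "p i = (\<Sum>j = 0..i. pochhammer (2 * B + 1) j / fact j * norm ((P ^ j) $ i))" for i
  have "norm (gamma_ratio_fps a b $ m) \<le> (\<Sum>i = 0..m. (B ^ i / fact i) * p (m - i))"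
    if a: "norm a \<le> B" and b: "norm b \<le> B" for a b
  proof -
    have "norm (b - a - 1) \<le> norm b + norm a + 1"
      using norm_triangle_ineq4[of b a] norm_triangle_ineq4[of "b - a" 1] by simp
    then have c: "norm (b - a - 1) \<le> 2 * B + 1" using a b by simp
    have "norm ((fps_binomial (b - a - 1) oo P) $ i) \<le> p i" for i
      unfolding fps_compose_nth p_def
      by (intro sum_norm_le) (unfold norm_mult fps_binomial_nth, intro mult_right_mono norm_gbinomial_le[OF c] norm_ge_zero)
    moreover have "norm (fps_exp (- a) $ i) \<le> B ^ i / fact i" for i
      using a by (simp add: norm_divide norm_power divide_right_mono power_mono)
    moreover have "0 \<le> B" using a norm_ge_zero[of a] by linarith
    ultimately show ?thesis
      unfolding gamma_ratio_fps_def fps_powr_def P_def[symmetric] fps_mult_nth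
      by (intro sum_norm_le) (unfold norm_mult, intro mult_mono, auto)
  qed
  then show ?thesis by blast
qed

section \<open>Generating function of the coefficients \<open>t_coeff\<close>\<close>

text \<open>Up to the factor \<open>cosh \<alpha>\<close>, the sinh quotient has the series
  \<open>e^X P Q\<close> with \<open>Q = 1 - z X P\<close>. In the binomial expansion of
  \<open>Q^\<nu>\<close> the n-th term contributes \<open>(-z)^n X^n P^n\<close>; the factor
  \<open>X^n\<close> shifts the index to \<open>m - n\<close>, and
  \<open>e^(\<nu> X) P^(\<nu> + n)\<close> is the Gamma quotient series for
  \<open>a = -\<nu>\<close>, \<open>b = n + 1\<close>.\<close>

lemma t_coeff_conv_gamma_ratio_fps:
  fixes \<alpha> :: real and \<nu> :: complex
  defines "z \<equiv> complex_of_real ((1 - tanh \<alpha>) / 2)"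
  shows "t_coeff m \<nu> \<alpha> = fact m * (\<Sum>n\<le>m. pochhammer (- \<nu>) n / fact n * z ^ n
            * gamma_ratio_fps (- \<nu>) (of_nat n + 1) $ (m - n))"
proof -
  define P :: "complex fps" where "P = fps_shift 1 (1 - fps_exp (- 1))"
  \<comment> \<open>The unreduced forms \<open>x ^ 1\<close> and \<open>- 1 * x\<close> mirror
    \<open>fps_shift 1\<close> and \<open>fps_exp (- 1)\<close>.\<close>
  define p where "p x = (if x = 0 then 1 else (1 - exp (- 1 * x)) / x ^ 1)" for x :: complex
  define Q where "Q = 1 - fps_const z * (1 - fps_exp (- 1))"
  define q where "q x = 1 - z * (1 - exp (- 1 * x))" for x :: complex
  have P0: "P $ 0 = 1" by (simp add: P_def)
  have Q0: "Q $ 0 = 1" by (simp add: Q_def)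
  have XP: "fps_X * P = 1 - fps_exp (- 1)" unfolding P_def by (rule fps_X_mult_shift_exp)
  have "1 \<le> subdegree (1 - fps_exp (- 1) :: complex fps)"
    by (intro subdegree_geI) (auto simp: fps_eq_iff intro!: exI[of _ 1])
  then have p: "p has_fps_expansion P"
    unfolding p_def P_def by (intro fps_expansion_intros) simp_all
  have q: "q has_fps_expansion Q"
    unfolding q_def Q_def by (intro fps_expansion_intros)
  have cosh: "complex_of_real (cosh \<alpha>) = cosh (of_real \<alpha>)"
    by (simp add: cosh_def scaleR_conv_of_real exp_of_real[symmetric])
  have cosh_eq: "sinh_quot \<alpha> x = complex_of_real (cosh \<alpha>) * (exp (1 * x) * p x * q x)" for x
  proof (cases "x = 0")
    case False
    have "cosh \<alpha> * tanh \<alpha> = sinh \<alpha>" by (simp add: tanh_def)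
    then have "of_real (cosh \<alpha>) * z = complex_of_real (cosh \<alpha> - sinh \<alpha>) / 2"
      unfolding z_def of_real_mult[symmetric] by (simp add: algebra_simps flip: of_real_mult)
    also have "\<dots> = exp (- of_real \<alpha>) / 2"
      by (simp add: cosh_def sinh_def exp_of_real[symmetric] field_simps)
    finally have z: "of_real (cosh \<alpha>) * z = exp (- of_real \<alpha>) / 2" .
    have "sinh (x + of_real \<alpha>) = (exp x * exp (of_real \<alpha>) - exp (- x) * exp (- of_real \<alpha>)) / 2"
      by (simp add: sinh_def scaleR_conv_of_real exp_add[symmetric])
    moreover have "sinh (of_real \<alpha>) = (exp (of_real \<alpha>) - exp (- complex_of_real \<alpha>)) / 2"
      by (simp add: sinh_def scaleR_conv_of_real)
    moreover have "complex_of_real (cosh \<alpha>) = (exp (of_real \<alpha>) + exp (- complex_of_real \<alpha>)) / 2"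
      unfolding cosh by (simp add: cosh_def scaleR_conv_of_real)
    \<comment> \<open>To be read with \<open>A = exp x\<close>, \<open>A' = exp (- x)\<close>,
      \<open>B = exp \<alpha>\<close>, \<open>B' = exp (- \<alpha>)\<close>: the left side is the
      sinh difference, and \<open>B' / 2\<close> is \<open>z * cosh \<alpha>\<close>.\<close>
    moreover have "(A * B - A' * B') / 2 - (B - B') / 2 = (A - 1) * ((B + B') / 2 - B' / 2 * (1 - A'))"
      if "A * A' = 1" for A A' B B' :: complex
    proof -
      have "(A - 1) * ((B + B') / 2 - B' / 2 * (1 - A')) = (A * B + (A * A') * B' - B - A' * B') / 2"
        by (simp add: field_simps)
      then show ?thesis unfolding that by (simp add: field_simps)
    qed
    moreover have "exp x * exp (- x) = 1" by (simp add: exp_minus)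
    ultimately have "sinh (x + of_real \<alpha>) - sinh (of_real \<alpha>)
        = (exp x - 1) * (of_real (cosh \<alpha>) - of_real (cosh \<alpha>) * z * (1 - exp (- x)))"
      unfolding z by (simp only:)
    also have "\<dots> = of_real (cosh \<alpha>) * (exp x * (1 - exp (- x)) * q x)"
      by (simp add: q_def exp_minus field_simps)
    finally show ?thesis using False by (simp add: sinh_quot_def p_def)
  qed (simp add: sinh_quot_def p_def q_def cosh)
  have "(\<lambda>x. (exp (1 * x) * p x * q x) powr \<nu>) has_fps_expansion fps_powr (fps_exp 1 * P * Q) \<nu>"
    using P0 Q0 by (intro has_fps_expansion_powr fps_expansion_intros p q) simp
  then have "fps_powr (fps_exp 1 * P * Q) \<nu> $ m
      = (deriv ^^ m) (\<lambda>x. (exp (1 * x) * p x * q x) powr \<nu>) 0 / fact m"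
    by (rule fps_nth_fps_expansion)
  moreover have "fps_powr (fps_exp 1 * P * Q) \<nu> = fps_exp \<nu> * fps_powr P \<nu> * fps_powr Q \<nu>"
    using P0 Q0 by (simp add: fps_powr_mult fps_powr_exp)
  ultimately have D: "(deriv ^^ m) (\<lambda>x. (exp (1 * x) * p x * q x) powr \<nu>) 0
      = fact m * (fps_exp \<nu> * fps_powr P \<nu> * fps_powr Q \<nu>) $ m"
    by simp
  define c where "c = complex_of_real (cosh \<alpha>) powr \<nu>"
  have "c \<noteq> 0" by (simp add: c_def)
  have an: "(\<lambda>x. (exp (1 * x) * p x * q x) powr \<nu>) analytic_on {0}"
    using \<open>_ has_fps_expansion fps_powr (fps_exp 1 * P * Q) \<nu>\<close> by (rule has_fps_expansion_imp_analytic_0)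
  \<comment> \<open>The factor \<open>cosh \<alpha>\<close> is a positive real, so it leaves the
    principal power without a jump between branches.\<close>
  have "(\<lambda>x. sinh_quot \<alpha> x powr \<nu>) = (\<lambda>x. c * (exp (1 * x) * p x * q x) powr \<nu>)"
    unfolding cosh_eq c_def by (subst powr_times_real_left) simp_all
  moreover have "(deriv ^^ m) (\<lambda>x. c * (exp (1 * x) * p x * q x) powr \<nu>) 0
      = c * (deriv ^^ m) (\<lambda>x. (exp (1 * x) * p x * q x) powr \<nu>) 0"
    by (rule higher_deriv_cmult') (rule an)
  ultimately have t: "t_coeff m \<nu> \<alpha> = fact m * (fps_exp \<nu> * fps_powr P \<nu> * fps_powr Q \<nu>) $ m"
    using \<open>c \<noteq> 0\<close> D by (simp add: t_coeff_def c_def[symmetric])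
  have E: "fps_exp \<nu> * fps_powr P \<nu> * P ^ n = gamma_ratio_fps (- \<nu>) (of_nat n + 1)" for n
    using fps_powr_add[OF P0, of \<nu> "of_nat n"] fps_powr_of_nat[OF P0, of n]
    unfolding gamma_ratio_fps_def P_def[symmetric] by (simp add: mult.assoc add.commute)
  have pw: "(Q - 1) ^ n = fps_const ((- z) ^ n) * (fps_X ^ n * P ^ n)" for n
  proof -
    have "Q - 1 = fps_const (- z) * (fps_X * P)"
      by (simp add: Q_def XP fps_const_neg[symmetric] del: fps_const_neg)
    then show ?thesis by (simp add: power_mult_distrib fps_const_power del: fps_const_neg)
  qed
  have "(fps_exp \<nu> * fps_powr P \<nu> * fps_powr Q \<nu>) $ m
      = (\<Sum>i\<le>m. (\<Sum>n\<le>m. (\<nu> gchoose n) * ((fps_exp \<nu> * fps_powr P \<nu>) $ i * ((Q - 1) ^ n) $ (m - i))))"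
  proof -
    \<comment> \<open>Terms with \<open>n > m - i\<close> vanish because \<open>(Q - 1) ^ n\<close>
      is divisible by \<open>X^n\<close>. Extending the range to \<open>m\<close> makes it
      independent of \<open>i\<close>, so that the two sums can be exchanged.\<close>
    have "fps_powr Q \<nu> $ (m - i) = (\<Sum>n\<le>m. (\<nu> gchoose n) * ((Q - 1) ^ n) $ (m - i))" for i
    proof -
      have "(\<Sum>n\<le>m. (\<nu> gchoose n) * ((Q - 1) ^ n) $ (m - i))
          = (\<Sum>n\<le>m - i. (\<nu> gchoose n) * ((Q - 1) ^ n) $ (m - i))"
        by (intro sum.mono_neutral_right) (auto simp: pw fps_X_power_mult_nth)
      then show ?thesis by (simp add: fps_powr_def fps_compose_nth atLeast0AtMost)
    qed
    then show ?thesis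
      unfolding fps_mult_nth[of "fps_exp \<nu> * fps_powr P \<nu>" "fps_powr Q \<nu>"] atLeast0AtMost
      by (simp add: sum_distrib_left mult_ac)
  qed
  also have "\<dots> = (\<Sum>n\<le>m. (\<nu> gchoose n) * (fps_exp \<nu> * fps_powr P \<nu> * (Q - 1) ^ n) $ m)"
    by (subst sum.swap) (simp add: fps_mult_nth[of "fps_exp \<nu> * fps_powr P \<nu>"] atLeast0AtMost sum_distrib_left)
  also have "\<dots> = (\<Sum>n\<le>m. pochhammer (- \<nu>) n / fact n * z ^ n
            * gamma_ratio_fps (- \<nu>) (of_nat n + 1) $ (m - n))"
  proof (intro sum.cong refl)
    fix n assume "n \<in> {..m}"
    have "fps_exp \<nu> * fps_powr P \<nu> * (Q - 1) ^ n
        = fps_const ((- z) ^ n) * (fps_X ^ n * gamma_ratio_fps (- \<nu>) (of_nat n + 1))"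
      unfolding pw E[symmetric] by (simp only: mult_ac)
    then have "(fps_exp \<nu> * fps_powr P \<nu> * (Q - 1) ^ n) $ m
        = (- z) ^ n * gamma_ratio_fps (- \<nu>) (of_nat n + 1) $ (m - n)"
      using \<open>n \<in> {..m}\<close> by (simp add: fps_X_power_mult_nth)
    moreover have "(\<nu> gchoose n) * (- z) ^ n = pochhammer (- \<nu>) n / fact n * z ^ n"
      by (simp add: gbinomial_pochhammer power_minus[of z] mult_ac)
    ultimately show "(\<nu> gchoose n) * (fps_exp \<nu> * fps_powr P \<nu> * (Q - 1) ^ n) $ m
        = pochhammer (- \<nu>) n / fact n * z ^ n * gamma_ratio_fps (- \<nu>) (of_nat n + 1) $ (m - n)"
      by (simp add: mult.assoc[symmetric])
  qed
  finally show ?thesis using t by simp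
qed

subsection \<open>Ratios of Gamma functions\<close>

text \<open>The binomial coefficients of all \<open>s\<close> in the disc are dominated by
  \<open>pochhammer B j / fact j\<close>, and for \<open>norm w\<close> at most 1/2 the resulting
  majorant is the convergent binomial series of \<open>(1 - 1/2) powr (- B)\<close>.\<close>

lemma binomial_taylor_bound:
  fixes B :: real
  shows "\<exists>C. \<forall>s w :: complex. norm s \<le> B \<longrightarrow> norm w \<le> 1 / 2 \<longrightarrow>
     norm ((1 + w) powr s - (\<Sum>j<J. (s gchoose j) * w ^ j)) \<le> C * norm w ^ J"
proof -
  define p where "p j = pochhammer B j / fact j * (1 / 2) ^ j" for j
  from gen_binomial_real[of "- 1 / 2" "- B"] have "summable (\<lambda>j. (- B gchoose j) * (- 1 / 2) ^ j)"
    using sums_summable by fastforce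
  moreover have "(- B gchoose j) * (- 1 / 2) ^ j = p j" for j
  proof -
    have *: "(1 / 2) ^ j = (- 1) ^ j * (- 1 / 2 :: real) ^ j"
      by (simp flip: power_mult_distrib)
    show ?thesis
      unfolding p_def * gbinomial_pochhammer minus_minus
      by (simp only: mult_ac times_divide_eq_left times_divide_eq_right)
  qed
  ultimately have p: "summable p" by simp
  \<comment> \<open>In the tail only \<open>j\<close> of the \<open>j + J\<close> factors
    \<open>w\<close> are bounded by 1/2, the other \<open>J\<close> give \<open>norm w ^ J\<close>;
    the factor \<open>2 ^ J\<close> makes up for the full power of 1/2 inside
    \<open>p (j + J)\<close>.\<close>
  define C where "C = 2 ^ J * (\<Sum>j. p (j + J))"
  have "norm ((1 + w) powr s - (\<Sum>j<J. (s gchoose j) * w ^ j)) \<le> C * norm w ^ J"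
    if s: "norm s \<le> B" and w: "norm w \<le> 1 / 2" for s w :: complex
  proof -
    have sums: "(\<lambda>j. (s gchoose j) * w ^ j) sums (1 + w) powr s"
      using w by (intro gen_binomial_complex) simp
    then have "(1 + w) powr s - (\<Sum>j<J. (s gchoose j) * w ^ j) = (\<Sum>j. (s gchoose (j + J)) * w ^ (j + J))"
      using suminf_split_initial_segment[OF sums_summable[OF sums], of J] sums_unique[OF sums] by simp
    also have "norm \<dots> \<le> (\<Sum>j. 2 ^ J * norm w ^ J * p (j + J))"
    proof (rule norm_suminf_le)
      fix j
      have "norm ((s gchoose (j + J)) * w ^ (j + J))
          \<le> pochhammer B (j + J) / fact (j + J) * ((1 / 2) ^ j * norm w ^ J)"
        unfolding norm_mult norm_power power_add using w
        by (intro mult_mono norm_gbinomial_le[OF s] power_mono order_trans[OF norm_ge_zero norm_gbinomial_le[OF s]]) auto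
      also have "\<dots> = 2 ^ J * norm w ^ J * p (j + J)"
        by (simp add: p_def power_add power_one_over)
      finally show "norm ((s gchoose (j + J)) * w ^ (j + J)) \<le> 2 ^ J * norm w ^ J * p (j + J)" .
    qed (use p in \<open>intro summable_mult summable_ignore_initial_segment\<close>)
    also have "\<dots> = C * norm w ^ J"
      using p by (subst suminf_mult) (auto simp: C_def intro: summable_ignore_initial_segment)
    finally show ?thesis .
  qed
  then show ?thesis by blast
qed

section \<open>Formal asymptotic coefficients of the Gamma quotient and their recurrence\<close>

text \<open>Termwise Laplace transformation sends \<open>s^(b-a-1+k)\<close> to
  \<open>Gamma (b - a + k) / \<mu>^(b-a+k)\<close>; division by \<open>Gamma (b - a)\<close> leaves
  the rising factorial. In this form the coefficient makes sense for all \<open>a\<close> and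
  \<open>b\<close>, also where the integral diverges.\<close>

definition gamma_ratio_coeff :: "complex \<Rightarrow> complex \<Rightarrow> nat \<Rightarrow> complex" where
  "gamma_ratio_coeff a b k = pochhammer (b - a) k * gamma_ratio_fps a b $ k"

definition gamma_ratio_poly :: "complex \<Rightarrow> complex \<Rightarrow> nat \<Rightarrow> complex \<Rightarrow> complex" where
  "gamma_ratio_poly a b N w = (\<Sum>k<N. gamma_ratio_coeff a b k * w ^ k)"

lemma gamma_ratio_coeff_0 [simp]: "gamma_ratio_coeff a b 0 = 1"
  by (simp add: gamma_ratio_coeff_def gamma_ratio_fps_def)

lemma gamma_ratio_coeff_bounded:
  "\<exists>C\<ge>0. \<forall>a b k. norm a \<le> B \<longrightarrow> norm b \<le> B \<longrightarrow> k < N \<longrightarrow> norm (gamma_ratio_coeff a b k) \<le> C"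
proof -
  obtain D where D: "\<And>k a b. norm a \<le> B \<Longrightarrow> norm b \<le> B \<Longrightarrow> norm (gamma_ratio_fps a b $ k) \<le> D k"
    using gamma_ratio_fps_bounded[of B] by metis
  define C where "C = (\<Sum>k<N. pochhammer (2 * B) k * \<bar>D k\<bar>)"
  have "norm (gamma_ratio_coeff a b k) \<le> \<bar>C\<bar>" if a: "norm a \<le> B" and b: "norm b \<le> B" and k: "k < N" for a b k
  proof -
    have "0 \<le> B" using a norm_ge_zero[of a] by linarith
    have *: "0 \<le> pochhammer (2 * B) i" for i
      using \<open>0 \<le> B\<close> by (auto simp: pochhammer_prod intro!: prod_nonneg)
    have "norm (pochhammer (b - a) k) \<le> pochhammer (2 * B) k"
      unfolding pochhammer_prod prod_norm[symmetric]
    proof (intro prod_mono conjI)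
      fix i show "norm (b - a + of_nat i) \<le> 2 * B + of_nat i"
        using norm_triangle_ineq[of "b - a" "of_nat i"] norm_triangle_ineq4[of b a] a b by simp
    qed auto
    then have "norm (gamma_ratio_coeff a b k) \<le> pochhammer (2 * B) k * \<bar>D k\<bar>"
      unfolding gamma_ratio_coeff_def norm_mult using D[OF a b, of k] * by (intro mult_mono) auto
    also have "\<dots> \<le> C"
      unfolding C_def using k * by (intro member_le_sum) auto
    finally show ?thesis by simp
  qed
  then show ?thesis by (intro exI[of _ "\<bar>C\<bar>"]) auto
qed

text \<open>The series recurrence is multiplied by \<open>pochhammer (b - a) m\<close>. Splitting
  that symbol at \<open>k\<close> turns the factors \<open>(-1)^j / j!\<close> into generalized
  binomial coefficients, namely those of the powers of \<open>1 + w\<close> that arise when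
  \<open>\<mu>\<close> is replaced by \<open>\<mu> + 1\<close>.\<close>

lemma gamma_ratio_coeff_rec:
  "(\<Sum>k\<le>m. gamma_ratio_coeff a b k *
        ((1 - (b - a) - of_nat k gchoose (Suc m - k)) + (b - 1) * (- (b - a) - of_nat k gchoose (m - k))))
     = a * gamma_ratio_coeff a b m"
proof -
  define \<beta> where "\<beta> = b - a"
  define E where "E = gamma_ratio_fps a b"
  have "(\<Sum>k\<le>m. gamma_ratio_coeff a b k *
        ((1 - \<beta> - of_nat k gchoose (Suc m - k)) + (b - 1) * (- \<beta> - of_nat k gchoose (m - k))))
    = (\<Sum>k\<le>m. pochhammer \<beta> m * ((- 1) ^ (m + 1 - k) / fact (m + 1 - k) * (\<beta> - 1 + of_nat k) * E $ k
        + (b - 1) * ((- 1) ^ (m - k) / fact (m - k) * E $ k)))"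
  proof (intro sum.cong refl)
    fix k assume "k \<in> {..m}"
    then have km: "k \<le> m" by simp
    then have p: "pochhammer \<beta> m = pochhammer \<beta> k * pochhammer (\<beta> + of_nat k) (m - k)"
      by (rule pochhammer_product)
    have 1: "(1 - \<beta> - of_nat k gchoose (Suc m - k))
        = (- 1) ^ (m + 1 - k) / fact (m + 1 - k) * ((\<beta> - 1 + of_nat k) * pochhammer (\<beta> + of_nat k) (m - k))"
    proof -
      have e: "Suc m - k = Suc (m - k)" "m + 1 - k = Suc (m - k)" using km by simp_all
      have "- (1 - \<beta> - of_nat k) = \<beta> - 1 + of_nat k" "\<beta> - 1 + of_nat k + 1 = \<beta> + of_nat k"
        by simp_all
      then have "pochhammer (- (1 - \<beta> - of_nat k)) (Suc (m - k))
          = (\<beta> - 1 + of_nat k) * pochhammer (\<beta> + of_nat k) (m - k)"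
        by (simp only: pochhammer_rec)
      then show ?thesis
        unfolding e gbinomial_pochhammer by (simp only: times_divide_eq_left)
    qed
    have 2: "(- \<beta> - of_nat k gchoose (m - k)) = (- 1) ^ (m - k) / fact (m - k) * pochhammer (\<beta> + of_nat k) (m - k)"
      by (simp add: gbinomial_pochhammer algebra_simps)
    show "gamma_ratio_coeff a b k *
        ((1 - \<beta> - of_nat k gchoose (Suc m - k)) + (b - 1) * (- \<beta> - of_nat k gchoose (m - k)))
      = pochhammer \<beta> m * ((- 1) ^ (m + 1 - k) / fact (m + 1 - k) * (\<beta> - 1 + of_nat k) * E $ k
        + (b - 1) * ((- 1) ^ (m - k) / fact (m - k) * E $ k))"
      unfolding 1 2 p gamma_ratio_coeff_def \<beta>_def[symmetric] E_def[symmetric] by algebra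
  qed
  also have "\<dots> = pochhammer \<beta> m * ((\<Sum>k\<le>m. (- 1) ^ (m + 1 - k) / fact (m + 1 - k) * (\<beta> - 1 + of_nat k) * E $ k)
        + (b - 1) * (\<Sum>k\<le>m. (- 1) ^ (m - k) / fact (m - k) * E $ k))"
    by (simp only: sum.distrib sum_distrib_left distrib_left)
  also have "\<dots> = pochhammer \<beta> m * (a * E $ m)"
    using gamma_ratio_fps_rec[where a = a and b = b and m = m] by (simp add: \<beta>_def E_def)
  finally show ?thesis by (simp add: \<beta>_def E_def gamma_ratio_coeff_def mult_ac)
qed

lemma sum_lessThan_triangle:
  fixes f :: "nat \<Rightarrow> nat \<Rightarrow> 'a :: comm_monoid_add"
  shows "(\<Sum>k<N. \<Sum>m\<in>{k..<N}. f k m) = (\<Sum>m<N. \<Sum>k\<le>m. f k m)"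
  unfolding sum.Sigma[OF finite_lessThan ballI[OF finite_atLeastLessThan]]
    sum.Sigma[OF finite_lessThan ballI[OF finite_atMost]]
  by (rule sum.reindex_bij_witness[of _ prod.swap prod.swap]) auto

text \<open>
  With \<open>w = 1 / \<mu>\<close>: the truncated expansion satisfies, up to its truncation order, the relation
  \<open>(\<mu> + b) q(\<mu> + 1) = (\<mu> + a) q(\<mu>)\<close> that \<open>q(\<mu>) = \<Gamma>(\<mu> + a) / \<Gamma>(\<mu> + b)\<close> satisfies exactly.
\<close>

lemma gamma_ratio_poly_shift:
  "\<exists>C. \<forall>a b w. norm a \<le> B \<longrightarrow> norm b \<le> B \<longrightarrow> norm w \<le> 1 / 2 \<longrightarrow>
     norm ((1 + b * w) * (1 + w) powr (a - b) * gamma_ratio_poly a b N (w / (1 + w))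
        - (1 + a * w) * gamma_ratio_poly a b N w) \<le> C * norm w ^ Suc N"
proof -
  define T where "T s J w = (\<Sum>j<J. (s gchoose j) * w ^ j)" for s w :: complex and J
  \<comment> \<open>Large enough for the exponents \<open>1 - (b - a) - k\<close> and
    \<open>- (b - a) - k\<close> with \<open>k < N\<close>.\<close>
  define B' where "B' = 2 * B + 1 + real N"
  have "\<forall>J. \<exists>C. \<forall>s w. norm s \<le> B' \<longrightarrow> norm w \<le> 1 / 2 \<longrightarrow> norm ((1 + w) powr s - T s J w) \<le> C * norm w ^ J"
    using binomial_taylor_bound unfolding T_def by blast
  then obtain D where D: "norm s \<le> B' \<Longrightarrow> norm w \<le> 1 / 2 \<Longrightarrow> norm ((1 + w) powr s - T s J w) \<le> D J * norm w ^ J" for J s w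
    by metis
  obtain c where c0: "c \<ge> 0"
    and c: "\<And>a b k. norm a \<le> B \<Longrightarrow> norm b \<le> B \<Longrightarrow> k < N \<Longrightarrow> norm (gamma_ratio_coeff a b k) \<le> c"
    using gamma_ratio_coeff_bounded by metis
  define C where "C = (\<Sum>k<N. c * (D (Suc N - k) + (B + 1) * D (N - k)))"
  have "norm ((1 + b * w) * (1 + w) powr (a - b) * gamma_ratio_poly a b N (w / (1 + w))
        - (1 + a * w) * gamma_ratio_poly a b N w) \<le> C * norm w ^ Suc N"
    if a: "norm a \<le> B" and b: "norm b \<le> B" and w: "norm w \<le> 1 / 2" for a b w
  proof -
    define \<beta> where "\<beta> = b - a"
    have "1 + w \<noteq> 0"
    proof
      assume "1 + w = 0"
      then have "w = - 1" by (simp add: add_eq_0_iff)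
      then show False using w by simp
    qed
    have N1: "norm \<beta> \<le> 2 * B" using norm_triangle_ineq4[of b a] a b by (simp add: \<beta>_def)
    define X where "X k = (1 + w) powr (1 - \<beta> - of_nat k)" for k
    define Y where "Y k = (1 + w) powr (- \<beta> - of_nat k)" for k
    define \<gamma> where "\<gamma> = gamma_ratio_coeff a b"
    have X: "norm (X k - T (1 - \<beta> - of_nat k) (Suc N - k) w) \<le> D (Suc N - k) * norm w ^ (Suc N - k)"
      if "k < N" for k
    proof -
      have "norm (1 - \<beta> - of_nat k) \<le> 1 + norm \<beta> + real k"
        using norm_triangle_ineq4[of "1 - \<beta>" "of_nat k"] norm_triangle_ineq4[of 1 \<beta>] by simp
      then have "norm (1 - \<beta> - of_nat k) \<le> B'" using N1 that by (simp add: B'_def)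
      then show ?thesis unfolding X_def using w by (rule D)
    qed
    have Y: "norm (Y k - T (- \<beta> - of_nat k) (N - k) w) \<le> D (N - k) * norm w ^ (N - k)"
      if "k < N" for k
    proof -
      have "norm (- \<beta> - of_nat k) \<le> norm \<beta> + real k"
        using norm_triangle_ineq4[of "- \<beta>" "of_nat k"] by simp
      then have "norm (- \<beta> - of_nat k) \<le> B'" using N1 that by (simp add: B'_def)
      then show ?thesis unfolding Y_def using w by (rule D)
    qed
    have "(1 + b * w) * (1 + w) powr (- \<beta>) * gamma_ratio_poly a b N (w / (1 + w))
        = (\<Sum>k<N. \<gamma> k * (w ^ k * X k + (b - 1) * w ^ Suc k * Y k))"
    proof -
      have "(1 + b * w) * (1 + w) powr (- \<beta>) * (\<gamma> k * (w / (1 + w)) ^ k)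
          = \<gamma> k * (w ^ k * X k + (b - 1) * w ^ Suc k * Y k)" for k
      proof -
        have "(1 + w) powr (- \<beta>) = (1 + w) ^ k * Y k" "X k = (1 + w) * Y k"
          using \<open>1 + w \<noteq> 0\<close> unfolding X_def Y_def
          by (simp_all add: powr_diff powr_minus powr_add field_simps)
        \<comment> \<open>The decomposition \<open>1 + b w = (1 + w) + (b - 1) w\<close> produces
          the two powers \<open>X k\<close> and \<open>Y k\<close> of \<open>1 + w\<close>.\<close>
        moreover have "(1 + b * w) * (q * y) * (g * (p / q)) = g * (p * ((1 + w) * y) + (b - 1) * (w * p) * y)"
          if "q \<noteq> 0" for q y g p :: complex
          using that by (simp add: field_simps)
        ultimately show ?thesis
          using \<open>1 + w \<noteq> 0\<close> by (simp only: power_divide power_Suc power_not_zero not_False_eq_True)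
      qed
      then show ?thesis unfolding gamma_ratio_poly_def \<gamma>_def[symmetric] sum_distrib_left by (simp only:)
    qed
    \<comment> \<open>With \<open>X k\<close> and \<open>Y k\<close> replaced by Taylor polynomials,
      cut so that every product stops at \<open>w ^ N\<close>, the shift relation is exact. The
      constant Taylor terms give the polynomial itself, and the coefficient of
      \<open>w ^ (m + 1)\<close> in the rest is \<open>a\<close> times the m-th coefficient by the
      recurrence.\<close>
    moreover have "(1 + a * w) * gamma_ratio_poly a b N w
        = (\<Sum>k<N. \<gamma> k * (w ^ k * T (1 - \<beta> - of_nat k) (Suc N - k) w
             + (b - 1) * w ^ Suc k * T (- \<beta> - of_nat k) (N - k) w))"
    proof -
      have "\<gamma> k * (w ^ k * T (1 - \<beta> - of_nat k) (Suc N - k) w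
             + (b - 1) * w ^ Suc k * T (- \<beta> - of_nat k) (N - k) w)
          = \<gamma> k * w ^ k + (\<Sum>m\<in>{k..<N}. \<gamma> k * ((1 - \<beta> - of_nat k gchoose (Suc m - k))
               + (b - 1) * (- \<beta> - of_nat k gchoose (m - k))) * w ^ Suc m)" if "k < N" for k
      proof -
        have "T (1 - \<beta> - of_nat k) (Suc N - k) w
            = 1 + (\<Sum>j<N - k. (1 - \<beta> - of_nat k gchoose Suc j) * w ^ Suc j)"
          unfolding T_def Suc_diff_le[OF less_imp_le[OF that]] by (subst sum.lessThan_Suc_shift) simp
        then have "\<gamma> k * (w ^ k * T (1 - \<beta> - of_nat k) (Suc N - k) w
             + (b - 1) * w ^ Suc k * T (- \<beta> - of_nat k) (N - k) w)
          = \<gamma> k * w ^ k + (\<Sum>j<N - k. \<gamma> k * ((1 - \<beta> - of_nat k gchoose Suc j)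
               + (b - 1) * (- \<beta> - of_nat k gchoose j)) * w ^ Suc (j + k))"
          unfolding T_def
          by (simp add: distrib_left distrib_right sum_distrib_left sum.distrib power_add mult_ac)
        also have "(\<Sum>j<N - k. \<gamma> k * ((1 - \<beta> - of_nat k gchoose Suc j)
               + (b - 1) * (- \<beta> - of_nat k gchoose j)) * w ^ Suc (j + k))
           = (\<Sum>m\<in>{k..<N}. \<gamma> k * ((1 - \<beta> - of_nat k gchoose (Suc m - k))
               + (b - 1) * (- \<beta> - of_nat k gchoose (m - k))) * w ^ Suc m)"
          by (rule sum.reindex_bij_witness[of _ "\<lambda>m. m - k" "\<lambda>j. j + k"]) (auto simp: Suc_diff_le)
        finally show ?thesis .
      qed
      then have "(\<Sum>k<N. \<gamma> k * (w ^ k * T (1 - \<beta> - of_nat k) (Suc N - k) w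
             + (b - 1) * w ^ Suc k * T (- \<beta> - of_nat k) (N - k) w))
        = (\<Sum>k<N. \<gamma> k * w ^ k) + (\<Sum>k<N. \<Sum>m\<in>{k..<N}. \<gamma> k * ((1 - \<beta> - of_nat k gchoose (Suc m - k))
               + (b - 1) * (- \<beta> - of_nat k gchoose (m - k))) * w ^ Suc m)"
        by (simp add: sum.distrib del: power_Suc)
      also have "\<dots> = (\<Sum>k<N. \<gamma> k * w ^ k) + (\<Sum>m<N. a * \<gamma> m * w ^ Suc m)"
        unfolding sum_lessThan_triangle sum_distrib_right[symmetric] \<gamma>_def \<beta>_def gamma_ratio_coeff_rec ..
      also have "\<dots> = (1 + a * w) * gamma_ratio_poly a b N w"
        unfolding gamma_ratio_poly_def \<gamma>_def distrib_right mult_1_left sum_distrib_left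
        by (simp add: sum.distrib mult_ac)
      finally show ?thesis ..
    qed
    ultimately have "norm ((1 + b * w) * (1 + w) powr (- \<beta>) * gamma_ratio_poly a b N (w / (1 + w))
        - (1 + a * w) * gamma_ratio_poly a b N w)
      = norm (\<Sum>k<N. \<gamma> k * (w ^ k * (X k - T (1 - \<beta> - of_nat k) (Suc N - k) w)
             + (b - 1) * w ^ Suc k * (Y k - T (- \<beta> - of_nat k) (N - k) w)))"
      by (simp add: sum_subtractf[symmetric] algebra_simps)
    also have "\<dots> \<le> (\<Sum>k<N. c * (D (Suc N - k) + (B + 1) * D (N - k)) * norm w ^ Suc N)"
    proof (rule sum_norm_le)
      fix k assume "k \<in> {..<N}"
      then have k: "k < N" by simp
      have pw: "norm w ^ k * norm w ^ (Suc N - k) = norm w ^ Suc N"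
        "norm w ^ Suc k * norm w ^ (N - k) = norm w ^ Suc N"
        using k by (simp_all flip: power_add)
      have b1: "norm (b - 1) \<le> B + 1" using norm_triangle_ineq4[of b 1] b by simp
      then have "0 \<le> B + 1" by (rule order_trans[OF norm_ge_zero])
      have "norm (w ^ k * (X k - T (1 - \<beta> - of_nat k) (Suc N - k) w))
          \<le> norm w ^ k * (D (Suc N - k) * norm w ^ (Suc N - k))"
        unfolding norm_mult norm_power by (intro mult_left_mono X k) auto
      moreover have "norm ((b - 1) * w ^ Suc k * (Y k - T (- \<beta> - of_nat k) (N - k) w))
          \<le> (B + 1) * norm w ^ Suc k * (D (N - k) * norm w ^ (N - k))"
        unfolding norm_mult norm_power using b1 \<open>0 \<le> B + 1\<close>
        by (intro mult_mono Y k order_trans[OF norm_ge_zero Y[OF k]]) auto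
      ultimately have le: "norm (w ^ k * (X k - T (1 - \<beta> - of_nat k) (Suc N - k) w)
             + (b - 1) * w ^ Suc k * (Y k - T (- \<beta> - of_nat k) (N - k) w))
          \<le> D (Suc N - k) * (norm w ^ k * norm w ^ (Suc N - k))
            + (B + 1) * D (N - k) * (norm w ^ Suc k * norm w ^ (N - k))"
        by (intro order_trans[OF norm_triangle_ineq]) (simp add: mult_ac)
      show "norm (\<gamma> k * (w ^ k * (X k - T (1 - \<beta> - of_nat k) (Suc N - k) w)
             + (b - 1) * w ^ Suc k * (Y k - T (- \<beta> - of_nat k) (N - k) w)))
          \<le> c * (D (Suc N - k) + (B + 1) * D (N - k)) * norm w ^ Suc N"
        using mult_mono[OF c[OF a b k] le c0 norm_ge_zero] unfolding pw norm_mult \<gamma>_def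
        by (simp only: algebra_simps)
    qed
    also have "\<dots> = C * norm w ^ Suc N" by (simp add: C_def sum_distrib_right)
    finally show ?thesis by (simp add: \<beta>_def)
  qed
  then show ?thesis by blast
qed

section \<open>Estimates along the sequence \<open>\<mu> + n\<close>\<close>

lemma norm_le_norm_add_of_nat:
  fixes \<mu> :: complex
  assumes "0 \<le> Re \<mu>"
  shows "norm \<mu> \<le> norm (\<mu> + of_nat j)"
  unfolding cmod_def using assms by (intro real_sqrt_le_mono add_mono) (auto intro!: power_mono)

text \<open>With \<open>r = norm \<mu>\<close>, the half-plane condition gives
  \<open>norm (\<mu> + j)^2 >= r^2 + j^2 >= (r + j)^2 / 2\<close>. Of the \<open>N + 1\<close>
  powers, \<open>N - 1\<close> are bounded below by \<open>r\<close> and the remaining square is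
  compared with the telescoping product \<open>(r + j - 1) (r + j)\<close>. The constant 4 is this 2
  times the 2 from \<open>1 / (r - 1) <= 2 / r\<close>.\<close>

lemma sum_inverse_power_shift_le:
  fixes \<mu> :: complex
  assumes "0 \<le> Re \<mu>" "2 \<le> norm \<mu>" "0 < N"
  shows "(\<Sum>j<n. 1 / norm (\<mu> + of_nat j) ^ Suc N) \<le> 4 / norm \<mu> ^ N"
proof -
  define r where "r = norm \<mu>"
  have r: "2 \<le> r" using assms by (simp add: r_def)
  have sq: "(r + real j)\<^sup>2 / 2 \<le> norm (\<mu> + of_nat j) ^ 2" for j
  proof -
    have "norm (\<mu> + of_nat j) ^ 2 = r\<^sup>2 + 2 * Re \<mu> * real j + (real j)\<^sup>2"
      unfolding r_def cmod_power2 by (simp add: power2_eq_square algebra_simps)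
    moreover have "0 \<le> 2 * Re \<mu> * real j" using assms by simp
    moreover have "0 \<le> (r - real j)\<^sup>2" by simp
    ultimately show ?thesis by (simp add: power2_eq_square algebra_simps)
  qed
  have ge: "r \<le> norm (\<mu> + of_nat j)" for j
    unfolding r_def using assms by (intro norm_le_norm_add_of_nat)
  have summand: "1 / norm (\<mu> + of_nat j) ^ Suc N \<le> 2 / r ^ (N - 1) * (1 / (r + real j - 1) - 1 / (r + real (Suc j) - 1))" for j
  proof -
    have pos: "0 < r + real j - 1" "0 < r + real j" using r by simp_all
    have "(r + real j - 1) * (r + real j) / 2 \<le> (r + real j)\<^sup>2 / 2"
      using pos by (simp add: power2_eq_square)
    also note sq
    finally have "r ^ (N - 1) * ((r + real j - 1) * (r + real j) / 2)
        \<le> norm (\<mu> + of_nat j) ^ (N - 1) * norm (\<mu> + of_nat j) ^ 2"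
      using r pos by (intro mult_mono power_mono ge) auto
    also have "\<dots> = norm (\<mu> + of_nat j) ^ Suc N"
      using \<open>0 < N\<close> by (simp flip: power_add)
    finally have "1 / norm (\<mu> + of_nat j) ^ Suc N \<le> 1 / (r ^ (N - 1) * ((r + real j - 1) * (r + real j) / 2))"
      using r pos less_le_trans[OF _ ge, of 0 j]
      by (intro divide_left_mono mult_pos_pos zero_less_power) auto
    also have "\<dots> = 2 / r ^ (N - 1) * (1 / ((r + real j - 1) * (r + real j)))" by simp
    also have "1 / ((r + real j - 1) * (r + real j)) = 1 / (r + real j - 1) - 1 / (r + real (Suc j) - 1)"
      using pos by (simp add: divide_simps)
    finally show ?thesis .
  qed
  have "(\<Sum>j<n. 1 / norm (\<mu> + of_nat j) ^ Suc N)
      \<le> (\<Sum>j<n. 2 / r ^ (N - 1) * (1 / (r + real j - 1) - 1 / (r + real (Suc j) - 1)))"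
    by (intro sum_mono summand)
  also have "\<dots> = 2 / r ^ (N - 1) * (1 / (r - 1) - 1 / (r + real n - 1))"
    unfolding sum_distrib_left[symmetric] by (subst sum_lessThan_telescope') simp
  also have "\<dots> \<le> 2 / r ^ (N - 1) * (2 / r)"
  proof (intro mult_left_mono)
    have "1 / (r - 1) \<le> 2 / r" using r by (simp add: divide_simps)
    moreover have "0 \<le> 1 / (r + real n - 1)" using r by simp
    ultimately show "1 / (r - 1) - 1 / (r + real n - 1) \<le> 2 / r" by linarith
  qed (use r in auto)
  also have "\<dots> = 4 / r ^ N"
    using \<open>0 < N\<close> by (cases N) simp_all
  finally show ?thesis by (simp add: r_def)
qed

text \<open>The argument of \<open>x\<close> is at most pi/2 in absolute value and that of
  \<open>1 + 1 / x\<close> is strictly smaller than pi/2, so their sum stays inside the principal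
  range and the logarithms add.\<close>

lemma powr_add_one:
  fixes x s :: complex
  assumes "0 \<le> Re x" "x \<noteq> 0"
  shows "(x + 1) powr s = x powr s * (1 + 1 / x) powr s"
proof -
  have *: "0 \<le> Re (1 / x)" using assms by (simp add: Re_divide)
  then have "0 < Re (1 + 1 / x)" by simp
  then have "1 + 1 / x \<noteq> 0" by (metis less_irrefl zero_complex.sel(1))
  have "\<bar>Im (Ln x)\<bar> \<le> pi / 2" using assms Re_Ln_pos_le by simp
  moreover have "\<bar>Im (Ln (1 + 1 / x))\<bar> < pi / 2" using * \<open>1 + 1 / x \<noteq> 0\<close> by (subst Re_Ln_pos_lt) auto
  ultimately have "Ln (x * (1 + 1 / x)) = Ln x + Ln (1 + 1 / x)"
    using assms \<open>1 + 1 / x \<noteq> 0\<close> by (intro Ln_times_simple) auto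
  moreover have "x * (1 + 1 / x) = x + 1" using assms by (simp add: field_simps)
  moreover have "x + 1 \<noteq> 0" using assms by (metis calculation(2) \<open>1 + 1 / x \<noteq> 0\<close> mult_eq_0_iff)
  ultimately show ?thesis
    using assms \<open>1 + 1 / x \<noteq> 0\<close> by (simp add: powr_def exp_add[symmetric] algebra_simps)
qed

text \<open>Euler's limit formula suffices: for \<open>n > 0\<close> the expression equals the
  product of \<open>Gamma (\<mu> + a)\<close> over its n-th Euler approximant, the n-th approximant
  of \<open>Gamma (\<mu> + b)\<close> over its limit, and a power of \<open>1 + \<mu> / n\<close>.
  Each of the three factors tends to 1.\<close>

lemma Gamma_ratio_shift_limit:
  fixes \<mu> a b :: complex
  assumes a: "\<mu> + a \<notin> \<int>\<^sub>\<le>\<^sub>0" and b: "\<mu> + b \<notin> \<int>\<^sub>\<le>\<^sub>0"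
  shows "(\<lambda>n. Gamma (\<mu> + of_nat n + a) / Gamma (\<mu> + of_nat n + b) * (\<mu> + of_nat n) powr (b - a)) \<longlonglongrightarrow> 1"
proof -
  have G: "(\<lambda>n. Gamma_series' z n) \<longlonglongrightarrow> Gamma z" for z :: complex
    by (rule Gamma_series'_LIMSEQ)
  have "(\<lambda>n. 1 + \<mu> / of_nat n) \<longlonglongrightarrow> 1 + 0"
    by (intro tendsto_add tendsto_const lim_const_over_n)
  then have "(\<lambda>n. (1 + \<mu> / of_nat n) powr (b - a)) \<longlonglongrightarrow> (1 + 0) powr (b - a)"
    by (intro tendsto_powr_complex tendsto_const) simp_all
  moreover have "(\<lambda>n. Gamma (\<mu> + a) / Gamma_series' (\<mu> + a) n) \<longlonglongrightarrow> Gamma (\<mu> + a) / Gamma (\<mu> + a)"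
    using a by (intro tendsto_divide tendsto_const G) (simp add: Gamma_eq_zero_iff)
  moreover have "(\<lambda>n. Gamma_series' (\<mu> + b) n / Gamma (\<mu> + b)) \<longlonglongrightarrow> Gamma (\<mu> + b) / Gamma (\<mu> + b)"
    using b by (intro tendsto_divide tendsto_const G) (simp add: Gamma_eq_zero_iff)
  ultimately have "(\<lambda>n. (Gamma (\<mu> + a) / Gamma_series' (\<mu> + a) n) * (Gamma_series' (\<mu> + b) n / Gamma (\<mu> + b))
      * (1 + \<mu> / of_nat n) powr (b - a)) \<longlonglongrightarrow>
      (Gamma (\<mu> + a) / Gamma (\<mu> + a)) * (Gamma (\<mu> + b) / Gamma (\<mu> + b)) * (1 + 0) powr (b - a)"
    by (intro tendsto_mult)
  then have "(\<lambda>n. (Gamma (\<mu> + a) / Gamma_series' (\<mu> + a) n) * (Gamma_series' (\<mu> + b) n / Gamma (\<mu> + b))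
      * (1 + \<mu> / of_nat n) powr (b - a)) \<longlonglongrightarrow> 1"
    using a b by (simp add: Gamma_eq_zero_iff)
  then show ?thesis
  proof (rule Lim_transform_eventually)
    show "\<forall>\<^sub>F n in sequentially. (Gamma (\<mu> + a) / Gamma_series' (\<mu> + a) n) * (Gamma_series' (\<mu> + b) n / Gamma (\<mu> + b))
      * (1 + \<mu> / of_nat n) powr (b - a)
      = Gamma (\<mu> + of_nat n + a) / Gamma (\<mu> + of_nat n + b) * (\<mu> + of_nat n) powr (b - a)"
      using eventually_gt_at_top[of 0]
    proof eventually_elim
      case (elim n)
      have "Gamma (\<mu> + of_nat n + c) = pochhammer (\<mu> + c) n * Gamma (\<mu> + c)" if "\<mu> + c \<notin> \<int>\<^sub>\<le>\<^sub>0" for c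
        using pochhammer_Gamma[OF that, of n] that by (simp add: Gamma_eq_zero_iff add_ac)
      then have G: "Gamma (\<mu> + of_nat n + a) = pochhammer (\<mu> + a) n * Gamma (\<mu> + a)"
        "Gamma (\<mu> + of_nat n + b) = pochhammer (\<mu> + b) n * Gamma (\<mu> + b)"
        using a b by auto
      define l where "l = complex_of_real (ln (real n))"
      have "\<mu> + of_nat n = of_real (real n) * (1 + \<mu> / of_nat n)"
        using elim by (simp add: field_simps)
      moreover have "(of_real (real n) * (1 + \<mu> / of_nat n)) powr (b - a)
          = of_real (real n) powr (b - a) * (1 + \<mu> / of_nat n) powr (b - a)"
        by (rule powr_times_real_left) simp_all
      ultimately have "(\<mu> + of_nat n) powr (b - a)
          = of_real (real n) powr (b - a) * (1 + \<mu> / of_nat n) powr (b - a)"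
        by (simp only:)
      also have "of_real (real n) powr (b - a) = exp ((b - a) * l)"
      proof -
        have "Ln (of_real (real n)) = l" unfolding l_def using elim by (intro Ln_of_real) simp
        then show ?thesis unfolding powr_def using elim by simp
      qed
      also have "\<dots> = exp ((\<mu> + b) * l) / exp ((\<mu> + a) * l)"
        by (simp add: exp_diff[symmetric] algebra_simps)
      finally have pw: "(\<mu> + of_nat n) powr (b - a)
          = exp ((\<mu> + b) * l) / exp ((\<mu> + a) * l) * (1 + \<mu> / of_nat n) powr (b - a)" .
      have GG: "Gamma_series' z n = fact (n - 1) * exp (z * l) / pochhammer z n" for z :: complex
        by (simp add: Gamma_series'_def l_def)
      have fold: "x / (f * e / y) * ((f * e' / y') / x') * q = y * x / (y' * x') * (e' / e * q)"
        if "f \<noteq> 0" for x f e y e' y' x' q :: complex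
      proof -
        have "x / (f * e / y) * ((f * e' / y') / x') * q = (f * (x * y * e' * q)) / (f * (e * y' * x'))"
          by (simp only: divide_divide_eq_left divide_divide_eq_right times_divide_eq_left
              times_divide_eq_right times_divide_times_eq mult_ac)
        also have "\<dots> = (x * y * e' * q) / (e * y' * x')"
          using that by (rule mult_divide_mult_cancel_left)
        finally show ?thesis by (simp add: mult_ac)
      qed
      show ?case unfolding G pw GG by (rule fold) simp
    qed
  qed
qed

text \<open>
  The quotient \<open>u\<close> of the two sides tends to 1 along \<open>\<mu> + n\<close>, and
  \<open>u(x) / u(x + 1) = 1 + O(x powr -(N + 1))\<close>; telescoping the product needs no Stirling formula and is
  uniform in the half-plane.
\<close>

theorem Gamma_ratio_expansion:
  fixes B :: real
  assumes "0 < N"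
  shows "\<exists>R C. 0 < R \<and> (\<forall>a b \<mu>. norm a \<le> B \<longrightarrow> norm b \<le> B \<longrightarrow> 0 \<le> Re \<mu> \<longrightarrow> R \<le> norm \<mu> \<longrightarrow>
     norm (Gamma (\<mu> + a) / Gamma (\<mu> + b) * \<mu> powr (b - a) - gamma_ratio_poly a b N (1 / \<mu>)) \<le> C / norm \<mu> ^ N)"
proof -
  obtain D where D: "\<And>a b w. norm a \<le> B \<Longrightarrow> norm b \<le> B \<Longrightarrow> norm w \<le> 1 / 2 \<Longrightarrow>
     norm ((1 + b * w) * (1 + w) powr (a - b) * gamma_ratio_poly a b N (w / (1 + w))
        - (1 + a * w) * gamma_ratio_poly a b N w) \<le> D * norm w ^ Suc N"
    using gamma_ratio_poly_shift[of B N] by metis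
  obtain c where c0: "c \<ge> 0"
    and c: "\<And>a b k. norm a \<le> B \<Longrightarrow> norm b \<le> B \<Longrightarrow> k < N \<Longrightarrow> norm (gamma_ratio_coeff a b k) \<le> c"
    using gamma_ratio_coeff_bounded[of B N] by metis
  define D' where "D' = \<bar>D\<bar>"
  \<comment> \<open>The summands serve in turn to get \<open>norm (1 / x) <= 1/2\<close>, to keep
    \<open>x + a\<close> and \<open>x + b\<close> off the poles and \<open>1 + a / x\<close> away
    from 0, to force \<open>norm (A x - 1) <= 1/2\<close>, and to get \<open>S <= 1\<close>.\<close>
  define R where "R = 2 + 2 * \<bar>B\<bar> + 2 * real N * c + 16 * D'"
  have R: "2 \<le> R" "2 * B < R" "2 * real N * c \<le> R" "16 * D' \<le> R"
  proof -
    have "0 \<le> 2 * real N * c" "0 \<le> 16 * D'" using c0 by (simp_all add: D'_def)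
    then show "2 \<le> R" "2 * B < R" "2 * real N * c \<le> R" "16 * D' \<le> R"
      using abs_ge_self[of B] abs_ge_zero[of B] unfolding R_def by linarith+
  qed
  \<comment> \<open>The 48 is \<open>3/2 * 2 * 16\<close>: the bound on \<open>A \<mu>\<close>, the
    factor 2 lost in estimating the exponential, and the 16 in \<open>S\<close>.\<close>
  have main: "norm (Gamma (\<mu> + a) / Gamma (\<mu> + b) * \<mu> powr (b - a) - gamma_ratio_poly a b N (1 / \<mu>))
      \<le> 48 * D' / norm \<mu> ^ N"
    if a: "norm a \<le> B" and b: "norm b \<le> B" and \<mu>: "0 \<le> Re \<mu>" "R \<le> norm \<mu>" for a b \<mu>
  proof -
    define A where "A x = gamma_ratio_poly a b N (1 / x)" for x
    define g where "g x = Gamma (x + a) / Gamma (x + b) * x powr (b - a)" for x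
    define u where "u x = g x / A x" for x
    have dom: "0 \<le> Re (\<mu> + of_nat j)" "R \<le> norm (\<mu> + of_nat j)" for j
    proof -
      show "0 \<le> Re (\<mu> + of_nat j)" using \<mu> by simp
      show "R \<le> norm (\<mu> + of_nat j)" using norm_le_norm_add_of_nat[of \<mu> j] \<mu> by simp
    qed
    have A1: "norm (A x - 1) \<le> real N * c / norm x" if x: "R \<le> norm x" for x
    proof -
      obtain M where M: "N = Suc M" using assms by (cases N) auto
      have x2: "2 \<le> norm x" using x R by simp
      have "A x - 1 = (\<Sum>k<M. gamma_ratio_coeff a b (Suc k) * (1 / x) ^ Suc k)"
        unfolding A_def gamma_ratio_poly_def M by (subst sum.lessThan_Suc_shift) simp
      also have "norm \<dots> \<le> (\<Sum>k<M. c * (1 / norm x))"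
      proof (rule sum_norm_le)
        fix k assume k: "k \<in> {..<M}"
        have "norm ((1 / x) ^ Suc k) = (1 / norm x) ^ Suc k" by (simp add: norm_divide norm_power)
        also have "\<dots> \<le> (1 / norm x) ^ 1"
          using x2 by (intro power_decreasing) (auto simp: divide_simps)
        finally show "norm (gamma_ratio_coeff a b (Suc k) * (1 / x) ^ Suc k) \<le> c * (1 / norm x)"
          unfolding norm_mult using c0 k M by (intro mult_mono c a b) auto
      qed
      also have "\<dots> \<le> real N * c / norm x"
        using c0 by (simp add: M del: of_nat_Suc) (intro divide_right_mono mult_right_mono, auto)
      finally show ?thesis .
    qed
    have A2: "norm (A x - 1) \<le> 1 / 2" if x: "R \<le> norm x" for x
    proof -
      have "real N * c / norm x \<le> 1 / 2" using x R by (simp add: divide_simps)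
      then show ?thesis using A1[OF x] by linarith
    qed
    have A3: "1 / 2 \<le> norm (A x)" "norm (A x) \<le> 3 / 2" if x: "R \<le> norm x" for x
      using A2[OF x] norm_triangle_ineq2[of 1 "1 - A x"] norm_triangle_ineq[of 1 "A x - 1"]
      by (simp_all add: norm_minus_commute)
    \<comment> \<open>If \<open>x + s = - k\<close> with \<open>Re x >= 0\<close>, then the real and
      imaginary parts of \<open>x\<close> are dominated in absolute value by those of
      \<open>s\<close>, contradicting \<open>norm s <= B < R\<close>.\<close>
    have nonpole: "x + s \<notin> \<int>\<^sub>\<le>\<^sub>0" if x: "0 \<le> Re x" "R \<le> norm x" and s: "norm s \<le> B" for x s :: complex
    proof
      assume "x + s \<in> \<int>\<^sub>\<le>\<^sub>0"
      then obtain k where "x + s = - of_nat k" by (elim nonpos_Ints_cases')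
      then have "Re x + Re s = - real k" "Im x + Im s = 0" by (simp_all add: complex_eq_iff)
      then have "\<bar>Re x\<bar> \<le> \<bar>Re s\<bar>" "\<bar>Im x\<bar> \<le> \<bar>Im s\<bar>" using x by auto
      then have "norm x \<le> norm s"
        unfolding cmod_def by (intro real_sqrt_le_mono add_mono) (auto simp: abs_le_square_iff)
      moreover have "0 \<le> B" using s norm_ge_zero[of s] by linarith
      ultimately show False using x s R by linarith
    qed
    have step: "\<exists>y. u x = u (x + 1) * (1 + y) \<and> norm y \<le> 4 * D' / norm x ^ Suc N"
      if x: "0 \<le> Re x" "R \<le> norm x" for x
    proof -
      define w where "w = 1 / x"
      have x0: "x \<noteq> 0" using x R by auto
      have w: "norm w \<le> 1 / 2" using x R by (simp add: w_def norm_divide divide_simps)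
      define r where "r = (1 + b * w) * (1 + w) powr (a - b) * gamma_ratio_poly a b N (w / (1 + w))
        - (1 + a * w) * gamma_ratio_poly a b N w"
      \<comment> \<open>The relative defect of the shift relation; both factors of its denominator
        have norm at least 1/2.\<close>
      define y where "y = r / ((1 + a * w) * A x)"
      have x1: "R \<le> norm (x + 1)" using norm_le_norm_add_of_nat[of x 1] x by simp
      have "x + 1 \<noteq> 0" using x1 R by auto
      have "1 + w \<noteq> 0" using \<open>x + 1 \<noteq> 0\<close> x0 by (simp add: w_def field_simps)
      have A: "A x \<noteq> 0" "A (x + 1) \<noteq> 0" using A3(1)[OF x(2)] A3(1)[OF x1] by auto
      have aw: "1 / 2 \<le> norm (1 + a * w)"
      proof -
        have "norm (a * w) \<le> B * norm w" unfolding norm_mult using a by (intro mult_right_mono) auto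
        also have "\<dots> \<le> 1 / 2" using x R by (simp add: w_def norm_divide divide_simps)
        finally show ?thesis using norm_triangle_ineq2[of 1 "- (a * w)"] by simp
      qed
      then have aw0: "1 + a * w \<noteq> 0" by auto
      have "norm r \<le> D * norm w ^ Suc N" unfolding r_def by (intro D a b w)
      also have "\<dots> \<le> D' * norm w ^ Suc N" unfolding D'_def by (intro mult_right_mono) auto
      finally have r: "norm r \<le> D' * norm w ^ Suc N" .
      have "norm y \<le> (D' * norm w ^ Suc N) / (1 / 2 * (1 / 2))"
        unfolding y_def norm_divide norm_mult
        using r aw A3(1)[OF x(2)] by (intro frac_le mult_mono) (auto simp: D'_def)
      also have "\<dots> = 4 * D' / norm x ^ Suc N" by (simp add: w_def norm_divide power_one_over)
      finally have "norm y \<le> 4 * D' / norm x ^ Suc N" .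
      moreover have "u x = u (x + 1) * (1 + y)"
      proof -
        have Ax: "A x = gamma_ratio_poly a b N w" by (simp add: A_def w_def)
        have Ax1: "A (x + 1) = gamma_ratio_poly a b N (w / (1 + w))"
          using x0 \<open>x + 1 \<noteq> 0\<close> by (simp add: A_def w_def field_simps)
        have y: "1 + y = (1 + b * w) * (1 + w) powr (a - b) * A (x + 1) / ((1 + a * w) * A x)"
        proof -
          have "(1 + a * w) * A x + r = (1 + b * w) * (1 + w) powr (a - b) * A (x + 1)"
            unfolding r_def Ax Ax1 by simp
          moreover have "1 + y = ((1 + a * w) * A x + r) / ((1 + a * w) * A x)"
            using A aw0 by (simp add: y_def add_divide_distrib)
          ultimately show ?thesis by (simp only:)
        qed
        have np: "x + a \<notin> \<int>\<^sub>\<le>\<^sub>0" "x + b \<notin> \<int>\<^sub>\<le>\<^sub>0" using nonpole x a b by auto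
        then have nz: "x + a \<noteq> 0" "x + b \<noteq> 0" "Gamma (x + a) \<noteq> 0" "Gamma (x + b) \<noteq> 0"
          by (auto simp: Gamma_eq_zero_iff)
        have "Gamma (x + 1 + a) = (x + a) * Gamma (x + a)" "Gamma (x + 1 + b) = (x + b) * Gamma (x + b)"
          using Gamma_plus1[OF np(1)] Gamma_plus1[OF np(2)] by (simp_all add: add_ac)
        moreover have "x + a = x * (1 + a * w)" "x + b = x * (1 + b * w)"
          using x0 by (simp_all add: w_def field_simps)
        ultimately have G: "Gamma (x + 1 + a) = x * (1 + a * w) * Gamma (x + a)"
          "Gamma (x + 1 + b) = x * (1 + b * w) * Gamma (x + b)" by auto
        have bw0: "1 + b * w \<noteq> 0" using nz \<open>x + b = x * (1 + b * w)\<close> by auto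
        have P: "(x + 1) powr (b - a) = x powr (b - a) * (1 + w) powr (b - a)"
          unfolding w_def using x x0 by (intro powr_add_one) auto
        have "(1 + w) powr (b - a) * (1 + w) powr (a - b) = 1"
          using \<open>1 + w \<noteq> 0\<close> by (simp flip: powr_add)
        moreover have "g1 / g2 * p / Ax = (x * aw * g1) / (x * bw * g2) * (p * p1) / Ax1 * (bw * p2 * Ax1 / (aw * Ax))"
          if "p1 * p2 = 1" "x \<noteq> 0" "aw \<noteq> 0" "bw \<noteq> 0" "Ax1 \<noteq> 0" "Ax \<noteq> 0" for g1 g2 p Ax x aw bw p1 p2 Ax1 :: complex
        proof -
          have "(x * aw * g1) / (x * bw * g2) * (p * p1) / Ax1 * (bw * p2 * Ax1 / (aw * Ax))
              = g1 / g2 * p * (p1 * p2) / Ax"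
            using that(2-) by (simp add: field_simps)
          then show ?thesis using that(1) by simp
        qed
        ultimately show ?thesis
          unfolding u_def g_def y G P using x0 aw0 bw0 A by blast
      qed
      ultimately show ?thesis by blast
    qed
    have "\<exists>y. \<forall>j. u (\<mu> + of_nat j) = u (\<mu> + of_nat (Suc j)) * (1 + y j)
        \<and> norm (y j) \<le> 4 * D' / norm (\<mu> + of_nat j) ^ Suc N"
      using step[OF dom] by (intro choice) (simp add: add_ac)
    then obtain y where y: "\<And>j. u (\<mu> + of_nat j) = u (\<mu> + of_nat (Suc j)) * (1 + y j)"
      "\<And>j. norm (y j) \<le> 4 * D' / norm (\<mu> + of_nat j) ^ Suc N" by blast
    have prod: "u \<mu> = u (\<mu> + of_nat n) * (\<Prod>j<n. 1 + y j)" for n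
    proof (induction n)
      case (Suc n)
      then show ?case using y(1)[of n] by (simp add: mult_ac)
    qed simp
    \<comment> \<open>The bound on the sum of all \<open>norm (y j)\<close>: the 4 from each single
      step times the 4 from the sum of inverse powers.\<close>
    define S where "S = 16 * D' / norm \<mu> ^ N"
    have S1: "S \<le> 1"
    proof -
      have "16 * D' \<le> norm \<mu> ^ 1" using \<mu> R by simp
      also have "\<dots> \<le> norm \<mu> ^ N" using \<mu> R assms by (intro power_increasing) auto
      finally show ?thesis using \<mu> R by (simp add: S_def divide_simps)
    qed
    have S0: "0 \<le> S" by (simp add: S_def D'_def)
    have bound: "norm ((\<Prod>j<n. 1 + y j) - 1) \<le> 2 * S" for n
    proof -
      have "(\<Sum>j<n. norm (y j)) \<le> (\<Sum>j<n. 4 * D' * (1 / norm (\<mu> + of_nat j) ^ Suc N))"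
        using y(2) by (intro sum_mono) simp
      also have "\<dots> = 4 * D' * (\<Sum>j<n. 1 / norm (\<mu> + of_nat j) ^ Suc N)"
        by (simp only: sum_distrib_left)
      also have "\<dots> \<le> 4 * D' * (4 / norm \<mu> ^ N)"
        using \<mu> R assms by (intro mult_left_mono sum_inverse_power_shift_le) (auto simp: D'_def)
      finally have sum_le: "(\<Sum>j<n. norm (y j)) \<le> S" by (simp add: S_def)
      have "norm ((\<Prod>j<n. 1 + y j) - 1) \<le> (\<Prod>j<n. 1 + norm (y j)) - 1"
        by (rule norm_prod_minus1_le_prod_minus1)
      also have "(\<Prod>j<n. 1 + norm (y j)) \<le> exp (\<Sum>j<n. norm (y j))"
        by (rule prod_le_exp_sum) simp
      also have "\<dots> \<le> exp S" using sum_le by simp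
      also have "exp S \<le> 1 + S + S\<^sup>2" using S0 S1 by (rule exp_bound)
      also have "\<dots> \<le> 1 + 2 * S" using S0 S1 by (simp add: power2_eq_square mult_left_le)
      finally show ?thesis by simp
    qed
    have lim: "(\<lambda>n. u (\<mu> + of_nat n)) \<longlonglongrightarrow> 1"
    proof -
      have g: "(\<lambda>n. g (\<mu> + of_nat n)) \<longlonglongrightarrow> 1"
        unfolding g_def using nonpole[OF \<mu>] a b by (intro Gamma_ratio_shift_limit) auto
      have inf: "filterlim (\<lambda>n. norm (\<mu> + of_nat n)) at_top sequentially"
        by (intro filterlim_compose[OF filterlim_norm_at_top] tendsto_add_filterlim_at_infinity[OF tendsto_const] tendsto_of_nat)
      have "(\<lambda>n. real N * c / norm (\<mu> + of_nat n)) \<longlonglongrightarrow> 0"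
        by (rule real_tendsto_divide_at_top[OF tendsto_const inf])
      then have "(\<lambda>n. A (\<mu> + of_nat n) - 1) \<longlonglongrightarrow> 0"
        by (rule Lim_null_comparison[rotated]) (simp add: A1 dom)
      then have "(\<lambda>n. A (\<mu> + of_nat n)) \<longlonglongrightarrow> 1" by (simp add: LIM_zero_iff)
      from tendsto_divide[OF g this] show ?thesis by (simp add: u_def)
    qed
    \<comment> \<open>The product itself need not be shown to converge: its deviation from 1 is at
      most \<open>2 * S\<close> for every \<open>n\<close>, and \<open>u (\<mu> + n)\<close> tends
      to 1, so the limit bounds \<open>u \<mu> - 1\<close>.\<close>
    have "(\<lambda>n. u (\<mu> + of_nat n) * ((\<Prod>j<n. 1 + y j) - 1)) = (\<lambda>n. u \<mu> - u (\<mu> + of_nat n))"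
      using prod by (intro ext) (simp add: algebra_simps)
    moreover have "(\<lambda>n. u \<mu> - u (\<mu> + of_nat n)) \<longlonglongrightarrow> u \<mu> - 1" by (intro tendsto_intros lim)
    ultimately have "(\<lambda>n. norm (u (\<mu> + of_nat n) * ((\<Prod>j<n. 1 + y j) - 1))) \<longlonglongrightarrow> norm (u \<mu> - 1)"
      by (simp add: tendsto_norm)
    moreover have "(\<lambda>n. norm (u (\<mu> + of_nat n)) * (2 * S)) \<longlonglongrightarrow> norm (1 :: complex) * (2 * S)"
      by (intro tendsto_intros lim)
    ultimately have "norm (u \<mu> - 1) \<le> norm (1 :: complex) * (2 * S)"
      by (rule LIMSEQ_le) (auto simp: norm_mult intro!: mult_left_mono bound exI[of _ 0])
    then have "norm (u \<mu> - 1) \<le> 2 * S" by simp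
    moreover have "g \<mu> - A \<mu> = A \<mu> * (u \<mu> - 1)"
      using A3(1)[OF \<mu>(2)] by (auto simp: u_def field_simps)
    ultimately have "norm (g \<mu> - A \<mu>) \<le> 3 / 2 * (2 * S)"
      using A3(2)[OF \<mu>(2)] by (simp only: norm_mult) (intro mult_mono, auto)
    then show ?thesis by (simp add: g_def A_def S_def)
  qed
  then show ?thesis using R by (intro exI[of _ R] exI[of _ "48 * D'"]) auto
qed

subsection \<open>Ferrers functions\<close>

lemma exp_mult_ferrers_P_neg_tanh:
  "exp (of_real \<alpha> * \<mu>) * ferrers_P_neg \<nu> \<mu> (tanh \<alpha>)
     = gauss_F (- \<nu>) (\<nu> + 1) (1 + \<mu>) (complex_of_real ((1 - tanh \<alpha>) / 2)) / Gamma (1 + \<mu>)"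
proof -
  have "(1 - tanh \<alpha>) / (1 + tanh \<alpha>) = (cosh \<alpha> - sinh \<alpha>) / (cosh \<alpha> + sinh \<alpha>)"
    by (simp add: tanh_def divide_simps)
  also have "\<dots> = exp (- (2 * \<alpha>))"
    by (simp add: cosh_minus_sinh cosh_plus_sinh exp_diff[symmetric])
  finally have "complex_of_real ((1 - tanh \<alpha>) / (1 + tanh \<alpha>)) powr (\<mu> / 2) = exp (- (of_real \<alpha> * \<mu>))"
    by (simp add: powr_def Ln_of_real mult_ac)
  then show ?thesis by (simp add: ferrers_P_neg_def exp_minus)
qed

text \<open>The double sum is collected by \<open>m = n + k\<close>, where
  \<open>pochhammer (\<nu> + 1) n\<close> and \<open>pochhammer (\<nu> + 1 + n) k\<close> merge into
  \<open>pochhammer (\<nu> + 1) m\<close>. Truncating the n-th Gamma quotient at order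
  \<open>K - n\<close> keeps exactly the powers with \<open>m < K\<close>.\<close>

lemma sum_gamma_ratio_poly_conv_t_coeff:
  fixes \<alpha> :: real and \<nu> \<mu> :: complex
  defines "z \<equiv> complex_of_real ((1 - tanh \<alpha>) / 2)"
  shows "(\<Sum>n<K. pochhammer (- \<nu>) n * pochhammer (\<nu> + 1) n / fact n * z ^ n
            * (gamma_ratio_poly (- \<nu>) (of_nat n + 1) (K - n) (1 / \<mu>) / \<mu> ^ n))
       = (\<Sum>k<K. pochhammer (\<nu> + 1) k * t_coeff k \<nu> \<alpha> / fact k / \<mu> ^ k)"
proof -
  define f where "f n m = pochhammer (\<nu> + 1) m * (pochhammer (- \<nu>) n / fact n * z ^ n
            * gamma_ratio_fps (- \<nu>) (of_nat n + 1) $ (m - n)) / \<mu> ^ m" for n m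
  have "(\<Sum>n<K. pochhammer (- \<nu>) n * pochhammer (\<nu> + 1) n / fact n * z ^ n
            * (gamma_ratio_poly (- \<nu>) (of_nat n + 1) (K - n) (1 / \<mu>) / \<mu> ^ n))
      = (\<Sum>n<K. \<Sum>m\<in>{n..<K}. f n m)"
  proof (intro sum.cong refl)
    fix n assume "n \<in> {..<K}"
    have "pochhammer (- \<nu>) n * pochhammer (\<nu> + 1) n / fact n * z ^ n
            * (gamma_ratio_poly (- \<nu>) (of_nat n + 1) (K - n) (1 / \<mu>) / \<mu> ^ n)
        = (\<Sum>k<K - n. f n (k + n))"
      unfolding gamma_ratio_poly_def sum_divide_distrib sum_distrib_left
    proof (intro sum.cong refl)
      fix k
      have "pochhammer (\<nu> + 1) (k + n) = pochhammer (\<nu> + 1) n * pochhammer (of_nat n + 1 - - \<nu>) k"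
        using pochhammer_product'[of "\<nu> + 1" n k] by (simp add: add_ac)
      then show "pochhammer (- \<nu>) n * pochhammer (\<nu> + 1) n / fact n * z ^ n
            * (gamma_ratio_coeff (- \<nu>) (of_nat n + 1) k * (1 / \<mu>) ^ k / \<mu> ^ n) = f n (k + n)"
        unfolding f_def gamma_ratio_coeff_def by (simp add: power_add power_one_over divide_inverse power_inverse mult_ac)
    qed
    also have "\<dots> = (\<Sum>m\<in>{n..<K}. f n m)"
      by (rule sum.reindex_bij_witness[of _ "\<lambda>m. m - n" "\<lambda>k. k + n"]) auto
    finally show "pochhammer (- \<nu>) n * pochhammer (\<nu> + 1) n / fact n * z ^ n
            * (gamma_ratio_poly (- \<nu>) (of_nat n + 1) (K - n) (1 / \<mu>) / \<mu> ^ n) = (\<Sum>m\<in>{n..<K}. f n m)" .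
  qed
  also have "\<dots> = (\<Sum>m<K. \<Sum>n\<le>m. f n m)" by (rule sum_lessThan_triangle)
  also have "\<dots> = (\<Sum>k<K. pochhammer (\<nu> + 1) k * t_coeff k \<nu> \<alpha> / fact k / \<mu> ^ k)"
    by (simp add: f_def t_coeff_conv_gamma_ratio_fps z_def sum_distrib_left sum_divide_distrib mult_ac)
  finally show ?thesis .
qed

text \<open>Everything is multiplied by
  \<open>\<mu> powr (\<nu> + 1) * Gamma (\<mu> - \<nu>)\<close>, so that the error is measured by an
  integer power of \<open>norm \<mu>\<close>. The n-th hypergeometric term then contains a
  normalized Gamma quotient over \<open>\<mu> ^ n\<close>, and its expansion error of order
  \<open>K - n\<close> becomes one of order \<open>K\<close>.\<close>

lemma ferrers_P_neg_expansion:
  fixes e B :: real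
  assumes "0 < e" "0 < K"
  shows "\<exists>R C. 0 < R \<and> (\<forall>\<nu> \<mu> \<alpha>. norm \<nu> \<le> B \<longrightarrow> e \<le> Re \<mu> \<longrightarrow> R \<le> norm \<mu> \<longrightarrow>
     norm (\<mu> powr (\<nu> + 1) * (Gamma (\<mu> - \<nu>) * (exp (of_real \<alpha> * \<mu>) * ferrers_P_neg \<nu> \<mu> (tanh \<alpha>)))
        - (\<Sum>k<K. pochhammer (\<nu> + 1) k * t_coeff k \<nu> \<alpha> / fact k / \<mu> ^ k)) \<le> C / norm \<mu> ^ K)"
proof -
  \<comment> \<open>Must bound both parameters of the Gamma quotients, \<open>- \<nu>\<close> and
    \<open>n + 1\<close> for \<open>n < K\<close>.\<close>
  define B' where "B' = \<bar>B\<bar> + real K"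
  obtain C0 where C0: "\<And>\<nu> \<mu> z. norm \<nu> \<le> B \<Longrightarrow> e \<le> Re \<mu> \<Longrightarrow> norm z \<le> 1 \<Longrightarrow>
     norm (gauss_F (- \<nu>) (\<nu> + 1) (1 + \<mu>) z
        - (\<Sum>n<K. pochhammer (- \<nu>) n * pochhammer (\<nu> + 1) n / (pochhammer (1 + \<mu>) n * fact n) * z ^ n))
       \<le> C0 / norm \<mu> ^ K"
    using gauss_F_large_c[OF assms(1), of B K] by blast
  have "\<forall>n\<in>{..<K}. \<exists>R C. 0 < R \<and> (\<forall>a b \<mu>. norm a \<le> B' \<longrightarrow> norm b \<le> B' \<longrightarrow> 0 \<le> Re \<mu> \<longrightarrow> R \<le> norm \<mu> \<longrightarrow>
     norm (Gamma (\<mu> + a) / Gamma (\<mu> + b) * \<mu> powr (b - a) - gamma_ratio_poly a b (K - n) (1 / \<mu>))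
       \<le> C / norm \<mu> ^ (K - n))"
    by (intro ballI Gamma_ratio_expansion) simp
  from bchoice[OF this] obtain r where "\<forall>n\<in>{..<K}. \<exists>C. 0 < r n \<and>
     (\<forall>a b \<mu>. norm a \<le> B' \<longrightarrow> norm b \<le> B' \<longrightarrow> 0 \<le> Re \<mu> \<longrightarrow> r n \<le> norm \<mu> \<longrightarrow>
     norm (Gamma (\<mu> + a) / Gamma (\<mu> + b) * \<mu> powr (b - a) - gamma_ratio_poly a b (K - n) (1 / \<mu>))
       \<le> C / norm \<mu> ^ (K - n))" ..
  from bchoice[OF this] obtain c where "\<forall>n\<in>{..<K}. 0 < r n \<and>
     (\<forall>a b \<mu>. norm a \<le> B' \<longrightarrow> norm b \<le> B' \<longrightarrow> 0 \<le> Re \<mu> \<longrightarrow> r n \<le> norm \<mu> \<longrightarrow>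
     norm (Gamma (\<mu> + a) / Gamma (\<mu> + b) * \<mu> powr (b - a) - gamma_ratio_poly a b (K - n) (1 / \<mu>))
       \<le> c n / norm \<mu> ^ (K - n))" ..
  then have rc: "\<And>n. n < K \<Longrightarrow> 0 < r n"
    "\<And>n a b \<mu>. n < K \<Longrightarrow> norm a \<le> B' \<Longrightarrow> norm b \<le> B' \<Longrightarrow> 0 \<le> Re \<mu> \<Longrightarrow> r n \<le> norm \<mu> \<Longrightarrow>
     norm (Gamma (\<mu> + a) / Gamma (\<mu> + b) * \<mu> powr (b - a) - gamma_ratio_poly a b (K - n) (1 / \<mu>))
       \<le> c n / norm \<mu> ^ (K - n)"
    by blast+
  obtain d where d: "0 \<le> d"
    "\<And>a b k. norm a \<le> B' \<Longrightarrow> norm b \<le> B' \<Longrightarrow> k < K \<Longrightarrow> norm (gamma_ratio_coeff a b k) \<le> d"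
    using gamma_ratio_coeff_bounded[of B' K] by metis
  define p where "p n = (\<Prod>i<n. real i * (real i + 1) + (B * (B + 1) + 1))" for n
  define R where "R = 1 + (\<Sum>n<K. r n)"
  \<comment> \<open>The expansion errors of the \<open>K\<close> Gamma quotients, plus the
    hypergeometric tail constant \<open>C0\<close> times the bound on \<open>H 0\<close>.\<close>
  define C where "C = (\<Sum>n<K. p n / fact n * c n) + (real K * d + \<bar>c 0\<bar>) * C0"
  have r: "r n \<le> R" if "n < K" for n
    using that rc(1) member_le_sum[of n "{..<K}" r] unfolding R_def by fastforce
  have R: "1 \<le> R"
  proof -
    have "0 \<le> (\<Sum>n<K. r n)" using rc(1) by (intro sum_nonneg) (auto intro: less_imp_le)
    then show ?thesis by (simp add: R_def)
  qed
  have "norm (\<mu> powr (\<nu> + 1) * (Gamma (\<mu> - \<nu>) * (exp (of_real \<alpha> * \<mu>) * ferrers_P_neg \<nu> \<mu> (tanh \<alpha>)))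
        - (\<Sum>k<K. pochhammer (\<nu> + 1) k * t_coeff k \<nu> \<alpha> / fact k / \<mu> ^ k)) \<le> C / norm \<mu> ^ K"
    if \<nu>: "norm \<nu> \<le> B" and \<mu>: "e \<le> Re \<mu>" "R \<le> norm \<mu>" for \<nu> \<mu> and \<alpha> :: real
  proof -
    define z where "z = complex_of_real ((1 - tanh \<alpha>) / 2)"
    have z: "norm z \<le> 1"
      using tanh_real_bounds[of \<alpha>] unfolding z_def norm_of_real by auto
    have "0 \<le> B" using \<nu> norm_ge_zero[of \<nu>] by linarith
    have \<mu>0: "\<mu> \<noteq> 0" "0 \<le> Re \<mu>" "1 \<le> norm \<mu>" using \<mu> R assms by auto
    have \<nu>': "norm (- \<nu>) \<le> B'" using \<nu> by (simp add: B'_def)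
    have nB: "norm (of_nat n + 1 :: complex) \<le> B'" if "n < K" for n
    proof -
      have "norm (of_nat n + 1 :: complex) = real (Suc n)"
        using norm_of_nat[of "Suc n", where 'a = complex] by (simp add: add.commute)
      then show ?thesis using that by (simp add: B'_def)
    qed
    define H where "H n = Gamma (\<mu> - \<nu>) / Gamma (\<mu> + (of_nat n + 1)) * \<mu> powr (of_nat n + 1 + \<nu>)" for n
    define Q where "Q n = gamma_ratio_poly (- \<nu>) (of_nat n + 1) (K - n) (1 / \<mu>)" for n
    define q where "q n = pochhammer (- \<nu>) n * pochhammer (\<nu> + 1) n / fact n * z ^ n" for n
    define F where "F = gauss_F (- \<nu>) (\<nu> + 1) (1 + \<mu>) z"
    define \<tau> where "\<tau> = F - (\<Sum>n<K. q n / pochhammer (1 + \<mu>) n)"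
    have \<tau>: "norm \<tau> \<le> C0 / norm \<mu> ^ K"
      using C0[OF \<nu> \<mu>(1) z] by (simp add: \<tau>_def F_def q_def mult_ac)
    have H: "norm (H n - Q n) \<le> c n / norm \<mu> ^ (K - n)" if "n < K" for n
      using rc(2)[OF that \<nu>' nB[OF that] \<mu>0(2)] r[OF that] \<mu>(2)
      by (simp add: H_def Q_def)
    have H0: "norm (H 0) \<le> real K * d + \<bar>c 0\<bar>"
    proof -
      have "norm (Q 0) \<le> (\<Sum>k<K. d * 1)"
        unfolding Q_def gamma_ratio_poly_def
      proof (simp only: diff_zero, rule sum_norm_le)
        fix k assume k: "k \<in> {..<K}"
        have "norm (gamma_ratio_coeff (- \<nu>) (of_nat 0 + 1) k) \<le> d"
          using k nB[of 0] assms by (intro d(2) \<nu>') auto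
        moreover have "norm ((1 / \<mu>) ^ k) \<le> 1"
          unfolding norm_power using \<mu>0 by (intro power_le_one) (auto simp: norm_divide divide_simps)
        ultimately show "norm (gamma_ratio_coeff (- \<nu>) (of_nat 0 + 1) k * (1 / \<mu>) ^ k) \<le> d * 1"
          unfolding norm_mult using d(1) by (intro mult_mono) auto
      qed
      moreover have "c 0 / norm \<mu> ^ K \<le> \<bar>c 0\<bar> / 1"
        using \<mu>0 by (intro frac_le) auto
      ultimately show ?thesis
        using H[OF assms(2)] norm_triangle_sub[of "H 0" "Q 0"] by simp
    qed
    have np: "1 + \<mu> \<notin> \<int>\<^sub>\<le>\<^sub>0"
    proof
      assume "1 + \<mu> \<in> \<int>\<^sub>\<le>\<^sub>0"
      then obtain k where "1 + \<mu> = - of_nat k" by (elim nonpos_Ints_cases')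
      then have "1 + Re \<mu> = - real k" by (simp add: complex_eq_iff)
      then show False using \<mu>0 by linarith
    qed
    have G: "\<mu> powr (\<nu> + 1) * Gamma (\<mu> - \<nu>) / Gamma (1 + \<mu>) / pochhammer (1 + \<mu>) n = H n / \<mu> ^ n" for n
    proof -
      have "Gamma (\<mu> + (of_nat n + 1)) = pochhammer (1 + \<mu>) n * Gamma (1 + \<mu>)"
        using pochhammer_Gamma[OF np, of n] np by (simp add: Gamma_eq_zero_iff add_ac)
      moreover have "\<mu> powr (of_nat n + 1 + \<nu>) = \<mu> ^ n * \<mu> powr (\<nu> + 1)"
        using \<mu>0 powr_add[of \<mu> "of_nat n" "\<nu> + 1"] by (simp add: add_ac)
      ultimately show ?thesis using \<mu>0 by (simp add: H_def mult_ac)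
    qed
    have "\<mu> powr (\<nu> + 1) * (Gamma (\<mu> - \<nu>) * (exp (of_real \<alpha> * \<mu>) * ferrers_P_neg \<nu> \<mu> (tanh \<alpha>)))
        = \<mu> powr (\<nu> + 1) * Gamma (\<mu> - \<nu>) / Gamma (1 + \<mu>) * ((\<Sum>n<K. q n / pochhammer (1 + \<mu>) n) + \<tau>)"
      unfolding exp_mult_ferrers_P_neg_tanh \<tau>_def F_def z_def by simp
    also have "\<dots> = (\<Sum>n<K. q n * (\<mu> powr (\<nu> + 1) * Gamma (\<mu> - \<nu>) / Gamma (1 + \<mu>) / pochhammer (1 + \<mu>) n))
        + \<mu> powr (\<nu> + 1) * Gamma (\<mu> - \<nu>) / Gamma (1 + \<mu>) * \<tau>"
      unfolding distrib_left sum_distrib_left by (simp add: mult_ac)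
    \<comment> \<open>The prefactor of the tail is that of the term \<open>n = 0\<close>, namely
      \<open>H 0\<close>, which is bounded.\<close>
    also have "\<dots> = (\<Sum>n<K. q n * (H n / \<mu> ^ n)) + H 0 * \<tau>"
      unfolding G using G[of 0] by simp
    finally have "\<mu> powr (\<nu> + 1) * (Gamma (\<mu> - \<nu>) * (exp (of_real \<alpha> * \<mu>) * ferrers_P_neg \<nu> \<mu> (tanh \<alpha>)))
        - (\<Sum>n<K. q n * (Q n / \<mu> ^ n)) = (\<Sum>n<K. q n * ((H n - Q n) / \<mu> ^ n)) + H 0 * \<tau>"
      by (simp add: diff_divide_distrib right_diff_distrib sum_subtractf)
    moreover have "(\<Sum>n<K. q n * (Q n / \<mu> ^ n))
        = (\<Sum>k<K. pochhammer (\<nu> + 1) k * t_coeff k \<nu> \<alpha> / fact k / \<mu> ^ k)"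
      unfolding q_def Q_def z_def by (rule sum_gamma_ratio_poly_conv_t_coeff)
    moreover have "norm (\<Sum>n<K. q n * ((H n - Q n) / \<mu> ^ n)) \<le> (\<Sum>n<K. p n / fact n * c n / norm \<mu> ^ K)"
    proof (rule sum_norm_le)
      fix n assume "n \<in> {..<K}"
      then have n: "n < K" by simp
      have "norm (q n) \<le> p n / fact n * 1"
        unfolding q_def norm_mult[of _ "z ^ n"] p_def norm_divide norm_power
        using norm_pochhammer_mult_le[OF \<nu>, of n] z \<open>0 \<le> B\<close>
        by (intro mult_mono) (auto simp: divide_right_mono power_le_one intro!: divide_nonneg_nonneg prod_nonneg)
      moreover have "norm ((H n - Q n) / \<mu> ^ n) \<le> c n / norm \<mu> ^ (K - n) / norm \<mu> ^ n"
        unfolding norm_divide norm_power by (intro divide_right_mono H n) auto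
      ultimately have "norm (q n * ((H n - Q n) / \<mu> ^ n)) \<le> (p n / fact n * 1) * (c n / norm \<mu> ^ (K - n) / norm \<mu> ^ n)"
        unfolding norm_mult using \<open>0 \<le> B\<close>
        by (intro mult_mono) (auto simp: p_def intro!: divide_nonneg_nonneg prod_nonneg)
      also have "norm \<mu> ^ K = norm \<mu> ^ (K - n) * norm \<mu> ^ n"
        using n by (simp flip: power_add)
      then have "(p n / fact n * 1) * (c n / norm \<mu> ^ (K - n) / norm \<mu> ^ n) = p n / fact n * c n / norm \<mu> ^ K"
        by simp
      finally show "norm (q n * ((H n - Q n) / \<mu> ^ n)) \<le> p n / fact n * c n / norm \<mu> ^ K" .
    qed
    moreover have "norm (H 0 * \<tau>) \<le> (real K * d + \<bar>c 0\<bar>) * (C0 / norm \<mu> ^ K)"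
      unfolding norm_mult using H0 \<tau> d(1) by (intro mult_mono) auto
    ultimately have "norm (\<mu> powr (\<nu> + 1) * (Gamma (\<mu> - \<nu>) * (exp (of_real \<alpha> * \<mu>) * ferrers_P_neg \<nu> \<mu> (tanh \<alpha>)))
        - (\<Sum>k<K. pochhammer (\<nu> + 1) k * t_coeff k \<nu> \<alpha> / fact k / \<mu> ^ k))
      \<le> (\<Sum>n<K. p n / fact n * c n / norm \<mu> ^ K) + (real K * d + \<bar>c 0\<bar>) * (C0 / norm \<mu> ^ K)"
      by (simp only:) (rule norm_triangle_mono)
    also have "\<dots> = C / norm \<mu> ^ K"
      by (simp add: C_def add_divide_distrib sum_divide_distrib)
    finally show ?thesis .
  qed
  then show ?thesis using R by (intro exI[of _ R] exI[of _ C]) auto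
qed

text \<open>The O-term is an explicit remainder function; its constant is fixed before
  \<open>\<mu>\<close> and \<open>\<alpha>\<close>, which expresses the uniformity in
  \<open>\<alpha>\<close>.\<close>

theorem theorem6:
  fixes \<epsilon> :: real and L :: "complex set" and \<nu> :: "complex \<Rightarrow> complex" and K :: nat
  assumes "\<epsilon> > 0"
    and "curve_to_infinity L"
    and "L \<subseteq> {\<mu>. Re \<mu> \<ge> \<epsilon>}"
    and "\<exists>B. \<forall>\<^sub>F \<mu> in at_infinity_along L. norm (\<nu> \<mu>) \<le> B"
    and "\<forall>\<^sub>F \<mu> in at_infinity_along L. - 1 < Re (\<nu> \<mu>) \<and> Re (\<nu> \<mu>) < Re \<mu>"
    and "K > 0"
  shows "\<exists>(R :: complex \<Rightarrow> real \<Rightarrow> complex) (C :: real).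
    \<forall>\<^sub>F \<mu> in at_infinity_along L. \<forall>\<alpha> :: real.
      exp (of_real \<alpha> * \<mu>) * ferrers_P_neg (\<nu> \<mu>) \<mu> (tanh \<alpha>) =
        1 / Gamma (\<mu> - \<nu> \<mu>) *
          ((\<Sum>k<K. pochhammer (\<nu> \<mu> + 1) k * t_coeff k (\<nu> \<mu>) \<alpha> /
                   (\<mu> powr (of_nat k + \<nu> \<mu> + 1) * fact k)) + R \<mu> \<alpha>) \<and>
      norm (R \<mu> \<alpha>) \<le> C * norm (1 / \<mu> powr (of_nat K + \<nu> \<mu> + 1))"
proof -
  obtain B where B: "\<forall>\<^sub>F \<mu> in at_infinity_along L. norm (\<nu> \<mu>) \<le> B" using assms(4) by blast
  obtain r C where r: "0 < r" and C: "\<And>v \<mu> \<alpha>. norm v \<le> B \<Longrightarrow> \<epsilon> \<le> Re \<mu> \<Longrightarrow> r \<le> norm \<mu> \<Longrightarrow>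
     norm (\<mu> powr (v + 1) * (Gamma (\<mu> - v) * (exp (of_real \<alpha> * \<mu>) * ferrers_P_neg v \<mu> (tanh \<alpha>)))
        - (\<Sum>k<K. pochhammer (v + 1) k * t_coeff k v \<alpha> / fact k / \<mu> ^ k)) \<le> C / norm \<mu> ^ K"
    using ferrers_P_neg_expansion[OF assms(1,6), of B] by blast
  define P where "P \<mu> \<alpha> = exp (of_real \<alpha> * \<mu>) * ferrers_P_neg (\<nu> \<mu>) \<mu> (tanh \<alpha>)" for \<mu> \<alpha>
  define S where "S \<mu> \<alpha> = (\<Sum>k<K. pochhammer (\<nu> \<mu> + 1) k * t_coeff k (\<nu> \<mu>) \<alpha> /
                   (\<mu> powr (of_nat k + \<nu> \<mu> + 1) * fact k))" for \<mu> \<alpha>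
  define R where "R \<mu> \<alpha> = Gamma (\<mu> - \<nu> \<mu>) * P \<mu> \<alpha> - S \<mu> \<alpha>" for \<mu> \<alpha>
  have "\<forall>\<^sub>F \<mu> in at_infinity_along L. \<mu> \<in> L"
    by (simp add: at_infinity_along_def eventually_inf_principal)
  moreover have "\<forall>\<^sub>F \<mu> in at_infinity_along L. r \<le> norm \<mu>"
    unfolding at_infinity_along_def
    by (rule filter_leD[OF inf_le1]) (auto simp: eventually_at_infinity)
  ultimately have "\<forall>\<^sub>F \<mu> in at_infinity_along L. \<forall>\<alpha>.
      P \<mu> \<alpha> = 1 / Gamma (\<mu> - \<nu> \<mu>) * (S \<mu> \<alpha> + R \<mu> \<alpha>) \<and>
      norm (R \<mu> \<alpha>) \<le> C * norm (1 / \<mu> powr (of_nat K + \<nu> \<mu> + 1))"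
    using B assms(5)
  proof eventually_elim
    case (elim \<mu>)
    have \<mu>0: "\<mu> \<noteq> 0" using elim r by auto
    \<comment> \<open>Since \<open>Re (\<nu> \<mu>) < Re \<mu>\<close>, the Gamma factor is taken
      off its poles. At a pole it would be 0 by convention, and \<open>P\<close> could not be
      recovered from \<open>S + R\<close>.\<close>
    have "\<mu> - \<nu> \<mu> \<notin> \<int>\<^sub>\<le>\<^sub>0"
    proof
      assume "\<mu> - \<nu> \<mu> \<in> \<int>\<^sub>\<le>\<^sub>0"
      then obtain k where "\<mu> - \<nu> \<mu> = - of_nat k" by (elim nonpos_Ints_cases')
      then have "Re \<mu> - Re (\<nu> \<mu>) = - real k" by (simp add: complex_eq_iff)
      then show False using elim by linarith
    qed
    then have G: "Gamma (\<mu> - \<nu> \<mu>) \<noteq> 0" by (simp add: Gamma_eq_zero_iff)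
    have pw: "\<mu> powr (of_nat k + \<nu> \<mu> + 1) = \<mu> ^ k * \<mu> powr (\<nu> \<mu> + 1)" for k
      using \<mu>0 powr_add[of \<mu> "of_nat k" "\<nu> \<mu> + 1"] by (simp add: add.assoc)
    show ?case
    proof (intro allI conjI)
      fix \<alpha>
      show "P \<mu> \<alpha> = 1 / Gamma (\<mu> - \<nu> \<mu>) * (S \<mu> \<alpha> + R \<mu> \<alpha>)" using G by (simp add: R_def)
      have "\<mu> powr (\<nu> \<mu> + 1) * S \<mu> \<alpha>
          = (\<Sum>k<K. pochhammer (\<nu> \<mu> + 1) k * t_coeff k (\<nu> \<mu>) \<alpha> / fact k / \<mu> ^ k)"
        unfolding S_def pw sum_distrib_left using \<mu>0 by (intro sum.cong) (auto simp: field_simps)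
      then have "norm (\<mu> powr (\<nu> \<mu> + 1) * R \<mu> \<alpha>) \<le> C / norm \<mu> ^ K"
        using C[of "\<nu> \<mu>" \<mu> \<alpha>] elim assms(3) by (auto simp: R_def P_def right_diff_distrib)
      then show "norm (R \<mu> \<alpha>) \<le> C * norm (1 / \<mu> powr (of_nat K + \<nu> \<mu> + 1))"
        unfolding pw using \<mu>0 by (simp add: norm_mult norm_divide norm_power field_simps)
    qed
  qed
  then show ?thesis unfolding P_def S_def by blast
qed

end
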